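(* Let $p$ be a prime, $m\ge 1$ and $r$ integers with $r^p\equiv 1 \pmod m$, and let $G=\langle x, y\mid x^p=y^m=1,\ x^{-1}yx=y^r\rangle$ (so $G\cong C_p\ltimes C_m$ and $|G|=pm$). Assume that $p$ is the smallest prime divisor of $|G|$ and that $\gcd(p(r-1), m)=1$. Then $\mathsf d(G)=m+p-2$ and $\mathsf E(G)=\mathsf d(G)+|G|$.
   Context: A sequence over a finite multiplicatively written group $G$ is a finite unordered list of elements of $G$ with repetition allowed (an element of the free abelian monoid on $G$); its length is the number of terms. For a sequence $S=g_1\cdot\ldots\cdot g_\ell$, $\pi(S)=\{g_{\tau(1)}\cdots g_{\tau(\ell)}:\tau \text{ a permutation of } [1,\ell]\}$ is its set of products. $S$ is product-one if $1\in\pi(S)$. A subsequence is obtained by taking some of the terms (with multiplicity). The small Davenport constant $\mathsf d(G)$ is the maximal integer $\ell$ such that there is a sequence of length $\ell$ over $G$ having no nonempty product-one subsequence. $\mathsf E(G)$ is the smallest integer $t$ such that every sequence of length $t$ over $G$ contains a product-one subsequence of length $|G|$. *)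

theory Defs
  imports "HOL-Algebra.Algebra" "HOL-Library.Multiset" "HOL-Computational_Algebra.Primes"
begin

definition list_prod :: "('a, 'b) monoid_scheme \<Rightarrow> 'a list \<Rightarrow> 'a" where
  "list_prod G xs = foldr (\<lambda>x acc. x \<otimes>\<^bsub>G\<^esub> acc) xs \<one>\<^bsub>G\<^esub>"

(* sequences = finite multisets; pi(S) = set of products over all orderings *)
definition prod_set :: "('a, 'b) monoid_scheme \<Rightarrow> 'a multiset \<Rightarrow> 'a set" where
  "prod_set G S = {list_prod G xs | xs. mset xs = S}"

definition product_one :: "('a, 'b) monoid_scheme \<Rightarrow> 'a multiset \<Rightarrow> bool" where
  "product_one G S \<longleftrightarrow> \<one>\<^bsub>G\<^esub> \<in> prod_set G S"

definition product_one_free :: "('a, 'b) monoid_scheme \<Rightarrow> 'a multiset \<Rightarrow> bool" where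
  "product_one_free G S \<longleftrightarrow> \<not> (\<exists>T. T \<subseteq># S \<and> T \<noteq> {#} \<and> product_one G T)"

definition small_davenport :: "('a, 'b) monoid_scheme \<Rightarrow> nat" where
  "small_davenport G = Max {size S | S. set_mset S \<subseteq> carrier G \<and> product_one_free G S}"

definition E_const :: "('a, 'b) monoid_scheme \<Rightarrow> nat" where
  "E_const G = (LEAST t. \<forall>S. set_mset S \<subseteq> carrier G \<and> size S = t \<longrightarrow>
       (\<exists>T. T \<subseteq># S \<and> size T = order G \<and> product_one G T))"

end

theory Submission
  imports Defs "HOL-Number_Theory.Residues"
begin

text \<open>The hypotheses make \<open>r\<close> act without nontrivial fixed points on \<open>\<int>/m\<close>: all differences
  \<open>r\<^bsup>i\<^esup> - r\<^bsup>j\<^esup>\<close> with \<open>i \<noteq> j\<close> modulo \<open>p\<close> are units. The lower bounds come from \<open>y\<^bsup>m-1\<^esup> x\<^bsup>p-1\<^esup>\<close>,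
  padded with \<open>|G| - 1\<close> copies of the identity, and the padding also reduces the bound on \<open>d(G)\<close>
  to the one on \<open>E(G)\<close>. For the latter, a block of terms whose product lies in \<open>\<langle>y\<rangle>\<close> can be
  inserted anywhere into an ordering of another such block, which multiplies its exponent by a power
  of \<open>r\<close>. So each block offers a whole set of exponents, and one has to show that the sumset of
  these sets covers \<open>\<int>/m\<close>. Since all differences inside one set generate the same subgroup, Chowla's
  theorem gives Kneser-type growth for such sumsets. If growth fails, almost all exponents lie in a
  proper subgroup, and either the Erdos--Ginzburg--Ziv theorem applies there, or almost all
  exponents vanish and one extracts short product-one sequences repeatedly.\<close>

section \<open>Sumsets of residues\<close>

text \<open>The room in all the counts comes from one fact: \<open>r\<close> has exact order
  \<open>p\<close> modulo every prime factor of \<open>m\<close>, so all divisors of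
  \<open>m\<close> are 1 modulo \<open>p\<close>, and a divisor above 1 is at least 2p - 1, even 2p
  + 1 for odd \<open>p\<close>. The obstacle is that a factor r^k is available only at places of an
  ordering where the terms to the right have total class \<open>k\<close>, the class of a term being
  its exponent of \<open>x\<close> modulo \<open>p\<close>. If some nonzero class occurs
  \<open>p\<close> times, these \<open>p\<close> terms offer every power of \<open>r\<close>, and
  the other pm + m - 2 terms contain (m - 1) + (m - 1)/p blocks of length \<open>p\<close>, just
  enough. If no nonzero class does, at most (p - 1)^2 terms lie outside the powers of
  \<open>y\<close>; nearly every term is then a block by itself, and two factors, 1 and one other
  r^k, suffice when the exponents are spread out. The prescribed length pm is the second difficulty:
  a sumset argument decides freely which blocks occur. Hence selections are kept below
  \<open>m\<close> blocks and filled up, or vanishing blocks act as filler.\<close>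

definition periodic :: "int \<Rightarrow> int set \<Rightarrow> bool" where
  "periodic t E \<longleftrightarrow> (\<forall>x. x + t \<in> E \<longleftrightarrow> x \<in> E)"

text \<open>For an \<open>m\<close>-periodic set this is the size of its image in Z/m. Keeping
  subsets of Z/m as periodic sets of integers lets the modulus drop to a divisor without any
  translation of residue classes.\<close>

definition residue_count :: "int \<Rightarrow> int set \<Rightarrow> nat" where
  "residue_count m E = card (E \<inter> {0..<m})"

definition sumset :: "int set \<Rightarrow> int set \<Rightarrow> int set" where
  "sumset E A = {x + a | x a. x \<in> E \<and> a \<in> A}"

lemma periodic_mult:
  assumes "periodic t E"
  shows "x + k * t \<in> E \<longleftrightarrow> x \<in> E"
proof (induction k rule: int_induct[where k = 0])
  case base
  then show ?case by simp
next
  case (step1 i)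
  have "x + (i + 1) * t = (x + i * t) + t" by (simp add: algebra_simps)
  then show ?case using step1 assms by (metis periodic_def)
next
  case (step2 i)
  have "x + i * t = (x + (i - 1) * t) + t" by (simp add: algebra_simps)
  then show ?case using step2 assms by (metis periodic_def)
qed

lemma periodic_cong:
  assumes "periodic t E" "[x = y] (mod t)"
  shows "x \<in> E \<longleftrightarrow> y \<in> E"
proof -
  obtain k where "x = y + k * t"
    using assms(2) by (metis cong_iff_lin cong_sym mult.commute)
  then show ?thesis using periodic_mult[OF assms(1)] by simp
qed

text \<open>Forward closure suffices because \<open>t\<close> has finite order modulo
  \<open>m\<close>: a step back by \<open>t\<close> is \<open>m - 1\<close> steps forward, up to a
  multiple of \<open>m\<close>. Bezout then combines the periods \<open>t\<close> and
  \<open>m\<close>.\<close>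

lemma periodic_gcd:
  assumes "m > 0" "periodic m E" "\<And>x. x \<in> E \<Longrightarrow> x + t \<in> E"
  shows "periodic (gcd t m) E"
proof -
  have iter: "x + int n * t \<in> E" if "x \<in> E" for x n
  proof (induction n)
    case (Suc n)
    then show ?case using assms(3)[of "x + int n * t"] by (simp add: algebra_simps)
  qed (use that in simp)
  have "periodic t E"
    unfolding periodic_def
  proof (intro allI iffI)
    fix x
    assume "x + t \<in> E"
    then have "x + t + int (nat (m - 1)) * t \<in> E" by (rule iter)
    then have "x + t * m \<in> E" using assms(1) by (simp add: algebra_simps)
    then show "x \<in> E" using periodic_mult[OF assms(2)] by blast
  qed (rule assms(3))
  obtain u v where uv: "u * t + v * m = gcd t m"
    using bezout_int by blast
  show ?thesis
    unfolding periodic_def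
  proof
    fix x
    have "x + gcd t m = (x + u * t) + v * m" using uv by simp
    then show "x + gcd t m \<in> E \<longleftrightarrow> x \<in> E"
      using periodic_mult[OF assms(2)] periodic_mult[OF \<open>periodic t E\<close>] by metis
  qed
qed

lemma periodic_sumset:
  assumes "periodic m E"
  shows "periodic m (sumset E A)"
proof -
  have "x \<in> sumset E A \<Longrightarrow> x + k * m \<in> sumset E A" for x k
  proof -
    assume "x \<in> sumset E A"
    then obtain y a where "y \<in> E" "a \<in> A" "x = y + a" by (auto simp: sumset_def)
    then have "x + k * m = (y + k * m) + a" "y + k * m \<in> E"
      using periodic_mult[OF assms] by auto
    then show ?thesis using \<open>a \<in> A\<close> unfolding sumset_def by blast
  qed
  from this[of _ 1] this[of "_ + m" "-1"] show ?thesis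
    unfolding periodic_def by auto
qed

lemma subset_sumset:
  assumes "0 \<in> A"
  shows "E \<subseteq> sumset E A"
proof
  fix x assume "x \<in> E"
  then show "x \<in> sumset E A"
    unfolding sumset_def using assms by (intro CollectI exI[of _ x] exI[of _ 0]) simp
qed

lemma residue_count_mono: "E \<subseteq> Y \<Longrightarrow> residue_count m E \<le> residue_count m Y"
  unfolding residue_count_def by (rule card_mono) auto

lemma residue_count_Un_disjoint:
  "E \<inter> Y = {} \<Longrightarrow> residue_count m (E \<union> Y) = residue_count m E + residue_count m Y"
  unfolding residue_count_def Int_Un_distrib2 by (rule card_Un_disjoint) auto

lemma residue_count_full:
  assumes "m > 0" "periodic m E" "residue_count m E \<ge> nat m"
  shows "x \<in> E"
proof -
  have "E \<inter> {0..<m} = {0..<m}"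
    using assms(3) unfolding residue_count_def by (intro card_seteq) auto
  moreover have "x mod m \<in> {0..<m}" using assms(1) by simp
  ultimately have "x mod m \<in> E" by blast
  then show ?thesis
    using periodic_cong[OF assms(2), of "x mod m" x] by (simp add: cong_def)
qed

text \<open>Counting half of the transform in \<open>chowla_in_coset\<close>. The multiples
  \<open>k * m\<close> keep the adjoined part periodic, and injectivity modulo \<open>m\<close>
  keeps its classes distinct.\<close>

lemma residue_count_adjoin:
  assumes "m > 0" "periodic m E" "finite D" "inj_on (\<lambda>a. a mod m) D"
    and "\<And>a. a \<in> D \<Longrightarrow> e + a \<notin> E"
  shows "residue_count m (E \<union> {e + a + k * m | a k. a \<in> D}) = residue_count m E + card D"
proof -
  let ?Y = "{e + a + k * m | a k. a \<in> D}"
  have disj: "E \<inter> ?Y = {}"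
    using periodic_mult[OF assms(2)] assms(5) by auto
  have "?Y \<inter> {0..<m} = (\<lambda>a. (e + a) mod m) ` D"
  proof (intro equalityI subsetI)
    fix z assume z: "z \<in> ?Y \<inter> {0..<m}"
    then obtain a k where "a \<in> D" "z = e + a + k * m" by blast
    moreover have "z mod m = z" using z by simp
    ultimately have "z = (e + a) mod m" by (metis mod_mult_self1)
    then show "z \<in> (\<lambda>a. (e + a) mod m) ` D" using \<open>a \<in> D\<close> by auto
  next
    fix z assume "z \<in> (\<lambda>a. (e + a) mod m) ` D"
    then obtain a where a: "a \<in> D" "z = (e + a) mod m" by auto
    have "z = e + a + (- ((e + a) div m)) * m"
      using a(2) minus_div_mult_eq_mod[of "e + a" m] by (simp add: algebra_simps)
    then have "z \<in> ?Y" using a by blast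
    then show "z \<in> ?Y \<inter> {0..<m}" using a assms(1) by simp
  qed
  moreover have "inj_on (\<lambda>a. (e + a) mod m) D"
  proof (rule inj_onI)
    fix a b assume ab: "a \<in> D" "b \<in> D" "(e + a) mod m = (e + b) mod m"
    then have "[e + a = e + b] (mod m)" by (simp add: cong_def)
    then have "[a = b] (mod m)" using cong_add_lcancel by blast
    then show "a = b" using ab assms(4) by (auto simp: cong_def inj_on_def)
  qed
  ultimately have "residue_count m ?Y = card D"
    unfolding residue_count_def by (simp add: card_image)
  then show ?thesis using residue_count_Un_disjoint[OF disj] by simp
qed

text \<open>Chowla's variant of the Cauchy--Davenport theorem, inside one coset of \<open>g\<int>\<close>;
  the induction replaces \<open>(E, A)\<close> by \<open>(E \<union> (e + A), A \<inter> (E - e))\<close>.\<close>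

lemma chowla_in_coset:
  fixes m g x0 :: int
  assumes "m > 0" "finite A" "0 \<in> A" "inj_on (\<lambda>a. a mod m) A"
    and "\<And>u. u \<in> A \<Longrightarrow> u \<noteq> 0 \<Longrightarrow> gcd u m = g"
    and "periodic m E" "E \<noteq> {}" "\<And>x. x \<in> E \<Longrightarrow> [x = x0] (mod g)" "g dvd m"
  shows "residue_count m (sumset E A) + 1 \<ge> residue_count m E + card A
    \<or> {x. [x = x0] (mod g)} \<subseteq> sumset E A"
  using assms(2-8)
proof (induction "card A" arbitrary: A E rule: less_induct)
  case less
  show ?case
  proof (cases "A = {0}")
    case True
    then have "sumset E A = E" by (auto simp: sumset_def)
    then show ?thesis using True by simp
  next
    case False
    then obtain u where u: "u \<in> A" "u \<noteq> 0" using less.prems by blast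
    have g: "gcd u m = g" using u less.prems by blast
    show ?thesis
    proof (cases "\<forall>x\<in>E. x + u \<in> E")
      case True
      \<comment> \<open>Closure under \<open>u\<close> gives the period \<open>gcd u m = g\<close>,
        and a nonempty set of period \<open>g\<close> inside one class modulo \<open>g\<close> is
        the whole class.\<close>
      then have per: "periodic g E"
        using periodic_gcd[OF assms(1), of E u] less.prems g by auto
      obtain y where y: "y \<in> E" using less.prems by blast
      have "{x. [x = x0] (mod g)} \<subseteq> E"
      proof
        fix x assume "x \<in> {x. [x = x0] (mod g)}"
        then have "[x = y] (mod g)" using less.prems(7)[OF y] cong_sym cong_trans by blast
        then show "x \<in> E" using periodic_cong[OF per] y by blast
      qed
      then show ?thesis using subset_sumset[of A E] less.prems by blast
    next
      case False
      then obtain e where e: "e \<in> E" "e + u \<notin> E" by blast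
      \<comment> \<open>The elements that move \<open>e\<close> out of \<open>E\<close> are traded
        for their translates by \<open>e\<close>. Here \<open>u\<close> leaves \<open>A\<close> and
        \<open>0\<close> stays, so \<open>card A\<close> drops and the hypotheses survive.\<close>
      define A' where "A' = {a \<in> A. e + a \<in> E}"
      define E' where "E' = E \<union> {e + a + k * m | a k. a \<in> A - A'}"
      have "A' \<subset> A" using u e by (auto simp: A'_def)
      then have "card A' < card A" using less.prems psubset_card_mono by blast
      have "0 \<in> A'" using e less.prems by (auto simp: A'_def)
      have gu: "g dvd a" if "a \<in> A" for a
        using less.prems(4)[OF that] by (metis dvd_0_right gcd_dvd1)
      have per: "periodic m E'"
      proof -
        have "z + m = e + a + k * m \<longleftrightarrow> z = e + a + (k - 1) * m" for z a k
          by (auto simp: algebra_simps)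
        moreover have "(\<exists>k. z = e + a + (k - 1) * m) \<longleftrightarrow> (\<exists>k. z = e + a + k * m)" for z a
          by (metis add_diff_cancel_right')
        ultimately have "z + m \<in> {e + a + k * m | a k. a \<in> A - A'} \<longleftrightarrow> z \<in> {e + a + k * m | a k. a \<in> A - A'}" for z
          by simp
        then show ?thesis using less.prems(5) unfolding periodic_def E'_def by blast
      qed
      have coset: "[x = x0] (mod g)" if x: "x \<in> E'" for x
      proof (cases "x \<in> E")
        case False
        then obtain a k where "x = e + a + k * m" "a \<in> A" using x by (auto simp: E'_def)
        moreover have "g dvd a + k * m" using gu[OF \<open>a \<in> A\<close>] assms(9) by simp
        ultimately have "[x = e] (mod g)" by (simp add: cong_iff_dvd_diff)
        then show ?thesis using less.prems(7)[OF e(1)] cong_trans by blast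
      qed (use less.prems in blast)
      have IH: "residue_count m (sumset E' A') + 1 \<ge> residue_count m E' + card A'
         \<or> {x. [x = x0] (mod g)} \<subseteq> sumset E' A'"
      proof (rule less.hyps[OF \<open>card A' < card A\<close> _ \<open>0 \<in> A'\<close> _ _ per])
        show "finite A'" using \<open>A' \<subset> A\<close> less.prems finite_subset by blast
        show "inj_on (\<lambda>a. a mod m) A'" using \<open>A' \<subset> A\<close> less.prems inj_on_subset by blast
        show "gcd v m = g" if "v \<in> A'" "v \<noteq> 0" for v
          using that less.prems(4) \<open>A' \<subset> A\<close> by blast
        show "E' \<noteq> {}" using e by (auto simp: E'_def)
      qed (rule coset)
      have "residue_count m E' = residue_count m E + card (A - A')"
        unfolding E'_def
        by (rule residue_count_adjoin)
           (use assms(1) less.prems in \<open>auto simp: A'_def intro: inj_on_subset\<close>)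
      moreover have "card (A - A') + card A' = card A"
        using less.prems \<open>A' \<subset> A\<close>
        by (metis card_Diff_subset card_mono finite_subset le_add_diff_inverse2 psubset_imp_subset)
      ultimately have card: "residue_count m E' + card A' = residue_count m E + card A" by simp
      have sub: "sumset E' A' \<subseteq> sumset E A"
      proof
        fix z assume "z \<in> sumset E' A'"
        then obtain x a' where z: "x \<in> E'" "a' \<in> A'" "z = x + a'" by (auto simp: sumset_def)
        show "z \<in> sumset E A"
        proof (cases "x \<in> E")
          case True
          then show ?thesis using z by (auto simp: sumset_def A'_def)
        next
          case False
          then obtain a k where "x = e + a + k * m" "a \<in> A" using z by (auto simp: E'_def)
          \<comment> \<open>A sum of the new element e + a with a' regroups as (e + a') + a, and e +
            a' lies in \<open>E\<close> by the choice of \<open>A'\<close>.\<close>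
          moreover have "(e + a') + k * m \<in> E"
            using periodic_mult[OF less.prems(5)] z by (auto simp: A'_def)
          ultimately have "(e + a') + k * m + a \<in> sumset E A" by (auto simp: sumset_def)
          then show ?thesis using z \<open>x = _\<close> by (simp add: algebra_simps)
        qed
      qed
      show ?thesis
        using IH residue_count_mono[OF sub, of m] card sub by (auto simp del: One_nat_def)
    qed
  qed
qed

text \<open>\<open>A\<close> lies in gZ, so everything splits along the classes modulo
  \<open>g\<close>. Without the period \<open>g\<close>, some class meets the sumset but is not
  filled by it; there \<open>chowla_in_coset\<close> yields the whole gain, and in the other classes
  nothing of \<open>E\<close> is lost because \<open>0\<close> is in \<open>A\<close>.\<close>

lemma sumset_gain_or_periodic:
  fixes m g :: int
  assumes "m > 0" "finite A" "0 \<in> A" "inj_on (\<lambda>a. a mod m) A"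
    and gap: "\<And>u. u \<in> A \<Longrightarrow> u \<noteq> 0 \<Longrightarrow> gcd u m = g"
    and per: "periodic m E" and "g dvd m" "g \<ge> 0"
  shows "residue_count m (sumset E A) + 1 \<ge> residue_count m E + card A
    \<or> periodic g (sumset E A)"
proof (cases "periodic g (sumset E A)")
  case False
  moreover have "gcd g m = g" using assms(7,8) by simp
  ultimately obtain y where y: "y \<in> sumset E A" "y + g \<notin> sumset E A"
    using periodic_gcd[OF assms(1) periodic_sumset[OF per], of A g] by metis
  define C where "C = {z. [z = y] (mod g)}"
  have gu: "g dvd a" if "a \<in> A" for a
    using gap[OF that] by (metis dvd_0_right gcd_dvd1)
  have add_C: "x + a \<in> C \<longleftrightarrow> x \<in> C" if "g dvd a" for x a
    using that dvd_add_left_iff[of g a "x - y"] unfolding C_def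
    by (simp add: cong_iff_dvd_diff algebra_simps)
  have "y + g \<in> C" by (simp add: C_def cong_def)
  have "residue_count m (sumset (E \<inter> C) A) + 1 \<ge> residue_count m (E \<inter> C) + card A
    \<or> {x. [x = y] (mod g)} \<subseteq> sumset (E \<inter> C) A"
  proof (rule chowla_in_coset[OF assms(1-5)])
    show "periodic m (E \<inter> C)"
      using per add_C[OF assms(7)] by (auto simp: periodic_def)
    obtain x a where xa: "x \<in> E" "a \<in> A" "y = x + a" using y by (auto simp: sumset_def)
    have "y \<in> C" by (simp add: C_def)
    then have "x \<in> C" using add_C[OF gu[OF xa(2)], of x] xa(3) by simp
    then show "E \<inter> C \<noteq> {}" using xa by blast
  qed (use assms in \<open>auto simp: C_def\<close>)
  moreover have "sumset (E \<inter> C) A \<subseteq> sumset E A" by (auto simp: sumset_def)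
  ultimately have *: "residue_count m (sumset (E \<inter> C) A) + 1 \<ge> residue_count m (E \<inter> C) + card A"
    using y \<open>y + g \<in> C\<close> by (auto simp: C_def)
  have disj: "sumset (E \<inter> C) A \<inter> (E - C) = {}"
    using add_C[OF gu] by (auto simp: sumset_def)
  have "sumset (E \<inter> C) A \<union> (E - C) \<subseteq> sumset E A"
    using subset_sumset[OF assms(3)] \<open>sumset (E \<inter> C) A \<subseteq> sumset E A\<close> by blast
  from residue_count_mono[OF this, of m] residue_count_Un_disjoint[OF disj, of m]
  have "residue_count m (sumset E A) \<ge> residue_count m (sumset (E \<inter> C) A) + residue_count m (E - C)"
    by simp
  moreover have "residue_count m E = residue_count m (E \<inter> C) + residue_count m (E - C)"
    using residue_count_Un_disjoint[of "E \<inter> C" "E - C" m] by (simp add: Int_Diff_Un Int_Diff_disjoint)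
  ultimately show ?thesis
    using * by simp
qed simp

section \<open>Sumsets of finite families and covering of Z/m\<close>

definition sums_mod :: "nat \<Rightarrow> 'i set \<Rightarrow> ('i \<Rightarrow> int set) \<Rightarrow> int set" where
  "sums_mod m I A = {x. \<exists>f. (\<forall>i\<in>I. f i \<in> A i) \<and> [x = (\<Sum>i\<in>I. f i)] (mod int m)}"

lemma periodic_sums_mod: "periodic (int m) (sums_mod m I A)"
  by (simp add: periodic_def sums_mod_def cong_def)

lemma sums_mod_insert:
  assumes "finite I" "i \<notin> I"
  shows "sums_mod m (insert i I) A = sumset (sums_mod m I A) (A i)"
proof (intro equalityI subsetI)
  fix x assume "x \<in> sums_mod m (insert i I) A"
  then obtain f where f: "\<forall>j\<in>insert i I. f j \<in> A j" "[x = (\<Sum>j\<in>insert i I. f j)] (mod int m)"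
    by (auto simp: sums_mod_def)
  then have "[x - f i = (\<Sum>j\<in>I. f j)] (mod int m)"
    using assms by (simp add: cong_iff_dvd_diff algebra_simps)
  then have "x - f i \<in> sums_mod m I A" using f by (auto simp: sums_mod_def)
  then show "x \<in> sumset (sums_mod m I A) (A i)"
    unfolding sumset_def using f(1) by (intro CollectI exI[of _ "x - f i"] exI[of _ "f i"]) simp
next
  fix x assume "x \<in> sumset (sums_mod m I A) (A i)"
  then obtain y a f where "x = y + a" "a \<in> A i" "\<forall>j\<in>I. f j \<in> A j" "[y = (\<Sum>j\<in>I. f j)] (mod int m)"
    by (auto simp: sumset_def sums_mod_def)
  moreover from this have "(\<Sum>j\<in>I. (f(i := a)) j) = (\<Sum>j\<in>I. f j)"
    using assms(2) by (intro sum.cong) auto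
  ultimately have "\<forall>j\<in>insert i I. (f(i := a)) j \<in> A j"
    "[x = (\<Sum>j\<in>insert i I. (f(i := a)) j)] (mod int m)"
    using assms by (auto simp: cong_iff_dvd_diff algebra_simps)
  then show "x \<in> sums_mod m (insert i I) A" unfolding sums_mod_def by blast
qed

lemma periodic_sums_mod_superset:
  assumes "finite I" "I' \<subseteq> I" "periodic t (sums_mod m I' A)"
  shows "periodic t (sums_mod m I A)"
proof -
  have "finite J \<Longrightarrow> J \<inter> I' = {} \<Longrightarrow> periodic t (sums_mod m (J \<union> I') A)" for J
  proof (induction J rule: finite_induct)
    case (insert j J)
    then show ?case
      using sums_mod_insert[of "J \<union> I'" j m A] periodic_sumset finite_subset[OF assms(2,1)] by auto
  qed (use assms in simp)
  from this[of "I - I'"] show ?thesis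
    using assms by (simp add: Un_absorb2 Int_commute)
qed

lemma residue_count_sums_mod_empty:
  assumes "m \<ge> 1"
  shows "residue_count (int m) (sums_mod m {} A) = 1"
proof -
  have "x = 0" if "x \<in> {0..<int m}" "int m dvd x" for x
    using that zdvd_not_zless[of x "int m"] by (cases "x = 0") auto
  then have "sums_mod m {} A \<inter> {0..<int m} = {0}"
    using assms by (auto simp: sums_mod_def cong_0_iff)
  then show ?thesis by (simp add: residue_count_def)
qed

text \<open>A substitute for Kneser's theorem for sets \<open>A i\<close> whose differences all generate the same
  subgroup: if the total sumset has a proper period, pass to the quotient; otherwise no partial
  sumset is periodic, and every summand contributes its full gain.\<close>

theorem sums_cover:
  fixes A :: "'i \<Rightarrow> int set" and a :: "'i \<Rightarrow> int"
  assumes "finite I" "m \<ge> 1"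
    and "\<And>i. i \<in> I \<Longrightarrow> finite (A i)" "\<And>i. i \<in> I \<Longrightarrow> 0 \<in> A i"
    and "\<And>i u v. i \<in> I \<Longrightarrow> u \<in> A i \<Longrightarrow> v \<in> A i \<Longrightarrow> u \<noteq> v \<Longrightarrow> gcd (u - v) (int m) = gcd (a i) (int m)"
    and "\<And>d. d dvd m \<Longrightarrow> d > 1 \<Longrightarrow> d \<le> (\<Sum>i | i \<in> I \<and> \<not> int d dvd a i. card (A i) - 1) + 1"
  shows "\<exists>f. (\<forall>i\<in>I. f i \<in> A i) \<and> [t = (\<Sum>i\<in>I. f i)] (mod int m)"
proof -
  \<comment> \<open>The last hypothesis speaks of all divisors of \<open>m\<close> and so passes to
    every quotient Z/d, which makes induction on \<open>m\<close> possible.\<close>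
  have "t \<in> sums_mod m I A" for t
    using assms(2,5,6)
  proof (induction m arbitrary: t rule: less_induct)
    case (less m)
    let ?E = "sums_mod m I A"
    have m0: "int m > 0" using less.prems by simp
    show ?case
    proof (cases "\<exists>k. periodic k ?E \<and> \<not> int m dvd k")
      case True
      then obtain k where k: "periodic k ?E" "\<not> int m dvd k" by blast
      define d where "d = nat (gcd k (int m))"
      have d: "int d = gcd k (int m)" by (simp add: d_def)
      then have "int d dvd int m" by simp
      then have "d dvd m" by presburger
      moreover have "d \<noteq> m" using k d by (metis gcd_dvd1)
      ultimately have "d < m" using less.prems by (meson dvd_imp_le le_neq_implies_less less_le_trans zero_less_one)
      have "d \<ge> 1" using d m0 by (metis gcd_eq_0_iff int_ops(1) less_irrefl not_less_eq_eq One_nat_def le0 le_antisym)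
      have per: "periodic (int d) ?E"
        unfolding d using k(1) by (intro periodic_gcd[OF m0 periodic_sums_mod]) (auto simp: periodic_def)
      have gcd_d: "gcd u (int d) = gcd (gcd u (int m)) (int d)" for u
      proof -
        have "gcd (int m) (int d) = int d" using \<open>int d dvd int m\<close> by simp
        then show ?thesis by (simp add: gcd.assoc)
      qed
      have "t \<in> sums_mod d I A"
      proof (rule less.IH[OF \<open>d < m\<close> \<open>d \<ge> 1\<close>])
        show "gcd (u - v) (int d) = gcd (a i) (int d)"
          if "i \<in> I" "u \<in> A i" "v \<in> A i" "u \<noteq> v" for i u v
          using less.prems(2)[OF that] gcd_d by metis
        show "e \<le> (\<Sum>i | i \<in> I \<and> \<not> int e dvd a i. card (A i) - 1) + 1" if "e dvd d" "e > 1" for e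
          using less.prems(3)[of e] that \<open>d dvd m\<close> dvd_trans by blast
      qed
      then obtain f where f: "\<forall>i\<in>I. f i \<in> A i" "[t = (\<Sum>i\<in>I. f i)] (mod int d)"
        by (auto simp: sums_mod_def)
      \<comment> \<open>The solution modulo \<open>d\<close> is itself an element of the sumset
        modulo \<open>m\<close>, and it differs from \<open>t\<close> by a multiple of the period
        \<open>d\<close>.\<close>
      then have "(\<Sum>i\<in>I. f i) \<in> ?E" by (auto simp: sums_mod_def)
      then show ?thesis using periodic_cong[OF per f(2)] by simp
    next
      case aper: False
      have "finite I' \<Longrightarrow> I' \<subseteq> I \<Longrightarrow>
        residue_count (int m) (sums_mod m I' A) \<ge> (\<Sum>i | i \<in> I' \<and> \<not> int m dvd a i. card (A i) - 1) + 1" for I'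
      proof (induction I' rule: finite_induct)
        case empty
        show ?case using residue_count_sums_mod_empty[OF less.prems(1), of A] by simp
      next
        case (insert i I')
        let ?Y = "sums_mod m I' A"
        have ins: "sums_mod m (insert i I') A = sumset ?Y (A i)"
          using insert by (intro sums_mod_insert) auto
        have 0: "0 \<in> A i" "finite (A i)" using assms insert by auto
        show ?case
        \<comment> \<open>In both subcases of this condition the index adds nothing to the sum on
          the right, so no growth has to be shown.\<close>
        proof (cases "int m dvd a i \<or> A i = {0}")
          case True
          have "(\<Sum>j | j \<in> insert i I' \<and> \<not> int m dvd a j. card (A j) - 1)
             = (\<Sum>j | j \<in> I' \<and> \<not> int m dvd a j. card (A j) - 1)"
            using True insert.hyps
            by (intro sum.mono_neutral_cong_right) auto
          then show ?thesis
            using insert residue_count_mono[OF subset_sumset[OF 0(1), of ?Y], of "int m"] ins by simp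
        next
          case False
          then have na: "\<not> int m dvd a i" by blast
          have inj: "inj_on (\<lambda>x. x mod int m) (A i)"
          proof (rule inj_onI, rule ccontr)
            fix u v assume uv: "u \<in> A i" "v \<in> A i" "u mod int m = v mod int m" "u \<noteq> v"
            then have "int m dvd u - v" by (simp add: mod_eq_dvd_iff)
            then have "gcd (a i) (int m) = int m"
              using less.prems(2)[of i u v] uv insert.prems by simp
            then show False using na by (metis gcd_dvd1)
          qed
          have gap: "gcd u (int m) = gcd (a i) (int m)" if "u \<in> A i" "u \<noteq> 0" for u
            using less.prems(2)[of i u 0] that 0 insert.prems by simp
          \<comment> \<open>A period of a partial sumset persists in the total one, whose periods
            are all multiples of \<open>m\<close>, while \<open>gcd (a i) (int m)\<close> is a
            proper divisor of \<open>m\<close>.\<close>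
          have "\<not> periodic (gcd (a i) (int m)) (sumset ?Y (A i))"
          proof
            assume "periodic (gcd (a i) (int m)) (sumset ?Y (A i))"
            then have "periodic (gcd (a i) (int m)) ?E"
              using periodic_sums_mod_superset[OF assms(1) insert.prems] ins by metis
            then have "int m dvd gcd (a i) (int m)" using aper by blast
            then show False using na by (meson dvd_trans gcd_dvd1)
          qed
          then have "residue_count (int m) (sumset ?Y (A i)) + 1 \<ge> residue_count (int m) ?Y + card (A i)"
            using sumset_gain_or_periodic[OF m0 0(2,1) inj gap periodic_sums_mod, of I' A] by simp
          moreover have "{j. j \<in> insert i I' \<and> \<not> int m dvd a j} = insert i {j. j \<in> I' \<and> \<not> int m dvd a j}"
            using na by auto
          moreover have "card (A i) > 0" using 0 card_gt_0_iff by blast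
          ultimately show ?thesis
            using insert ins by simp
        qed
      qed
      \<comment> \<open>The divisor hypothesis covers only divisors above 1; for
        \<open>m = 1\<close> the summand \<open>+ 1\<close> alone gives the bound.\<close>
      from this[of I] have "residue_count (int m) ?E \<ge> m"
        using assms(1) less.prems(3)[of m] less.prems(1) by (cases "m = 1") auto
      then show ?thesis
        using residue_count_full[OF m0 periodic_sums_mod] by simp
    qed
  qed
  then show ?thesis by (auto simp: sums_mod_def)
qed

lemma sums_mod_two_point:
  assumes "finite I"
  shows "t \<in> sums_mod m I (\<lambda>i. {0, u i}) \<longleftrightarrow> (\<exists>F\<subseteq>I. [t = (\<Sum>i\<in>F. u i)] (mod int m))"
proof
  assume "t \<in> sums_mod m I (\<lambda>i. {0, u i})"
  then obtain f where f: "\<forall>i\<in>I. f i = 0 \<or> f i = u i" "[t = (\<Sum>i\<in>I. f i)] (mod int m)"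
    by (auto simp: sums_mod_def)
  have "(\<Sum>i\<in>I. f i) = (\<Sum>i\<in>{i \<in> I. f i \<noteq> 0}. u i)"
    using f(1) assms by (intro sum.mono_neutral_cong_right) auto
  then show "\<exists>F\<subseteq>I. [t = (\<Sum>i\<in>F. u i)] (mod int m)"
    using f(2) by (intro exI[of _ "{i \<in> I. f i \<noteq> 0}"]) auto
next
  assume "\<exists>F\<subseteq>I. [t = (\<Sum>i\<in>F. u i)] (mod int m)"
  then obtain F where F: "F \<subseteq> I" "[t = (\<Sum>i\<in>F. u i)] (mod int m)" by blast
  have "(\<Sum>i\<in>I. if i \<in> F then u i else 0) = (\<Sum>i\<in>F. u i)"
    using F(1) assms by (simp add: sum.If_cases inf.absorb2)
  then show "t \<in> sums_mod m I (\<lambda>i. {0, u i})"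
    unfolding sums_mod_def using F(2)
    by (intro CollectI exI[of _ "\<lambda>i. if i \<in> F then u i else 0"]) auto
qed

text \<open>Greedy choice: an index that does not enlarge the sumset is dropped, and each kept one
  adds at least one residue to the single residue of the empty sum.\<close>

lemma sums_mod_generating_subset:
  assumes "finite I" "m \<ge> 1" "\<And>i. i \<in> I \<Longrightarrow> 0 \<in> A i"
  shows "\<exists>I'\<subseteq>I. sums_mod m I' A = sums_mod m I A \<and> card I' < residue_count (int m) (sums_mod m I A)"
  using assms(1,3)
proof (induction I rule: finite_induct)
  case empty
  show ?case using residue_count_sums_mod_empty[OF assms(2), of A] by simp
next
  case (insert i I)
  then obtain I' where I': "I' \<subseteq> I" "sums_mod m I' A = sums_mod m I A"
    "card I' < residue_count (int m) (sums_mod m I A)" by auto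
  have "finite I'" "i \<notin> I'" using I' insert finite_subset by auto
  have eq: "sums_mod m (insert i I') A = sums_mod m (insert i I) A"
    using sums_mod_insert[OF \<open>finite I'\<close> \<open>i \<notin> I'\<close>] sums_mod_insert[OF insert(1,2)] I'(2) by simp
  show ?case
  proof (cases "sums_mod m (insert i I) A = sums_mod m I A")
    case True
    then show ?thesis using I' by auto
  next
    case False
    let ?E = "sums_mod m I A" and ?Y = "sums_mod m (insert i I) A"
    have "?E \<subset> ?Y"
      using False subset_sumset[of "A i" ?E] insert sums_mod_insert[OF insert(1,2)] by auto
    then obtain y where y: "y \<in> ?Y" "y \<notin> ?E" by blast
    have cong: "[y mod int m = y] (mod int m)" by (simp add: cong_def)
    have "y mod int m \<in> ?Y \<inter> {0..<int m}" "y mod int m \<notin> ?E \<inter> {0..<int m}"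
      using y periodic_cong[OF periodic_sums_mod cong] assms(2) by auto
    then have "?E \<inter> {0..<int m} \<subset> ?Y \<inter> {0..<int m}" using \<open>?E \<subset> ?Y\<close> by blast
    then have "residue_count (int m) ?E < residue_count (int m) ?Y"
      unfolding residue_count_def by (rule psubset_card_mono[rotated]) simp
    then show ?thesis
      using I' eq \<open>finite I'\<close> \<open>i \<notin> I'\<close> by (intro exI[of _ "insert i I'"]) auto
  qed
qed

text \<open>\<open>sums_cover\<close> for two-point sets, each gaining 1; the unit \<open>k\<close>
  does not change any gcd with \<open>m\<close>. The bound on \<open>card I'\<close> lets a later
  selection of prescribed size contain \<open>I'\<close>.\<close>

lemma subset_sums_cover:
  fixes a :: "'i \<Rightarrow> int"
  assumes "finite I" "m \<ge> 1" "coprime k (int m)"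
    and "\<And>d. d dvd m \<Longrightarrow> d > 1 \<Longrightarrow> d \<le> card {i \<in> I. \<not> int d dvd a i} + 1"
  shows "\<exists>I'\<subseteq>I. card I' < m \<and> (\<forall>t. \<exists>F\<subseteq>I'. [t = (\<Sum>i\<in>F. k * a i)] (mod int m))"
proof -
  let ?A = "\<lambda>i. {0, k * a i}"
  have gcd_k: "gcd (k * a i) (int m) = gcd (a i) (int m)" for i
    using assms(3) by (metis coprime_commute gcd_mult_left_left_cancel)
  have full: "t \<in> sums_mod m I ?A" for t
  proof -
    have "\<exists>f. (\<forall>i\<in>I. f i \<in> ?A i) \<and> [t = (\<Sum>i\<in>I. f i)] (mod int m)"
    proof (rule sums_cover[where a = a])
      fix i u v assume "i \<in> I" "u \<in> ?A i" "v \<in> ?A i" "u \<noteq> v"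
      then show "gcd (u - v) (int m) = gcd (a i) (int m)"
        using gcd_k[of i] by auto
    next
      fix d assume d: "d dvd m" "d > 1"
      have "card (?A i) - 1 = 1" if "\<not> int d dvd a i" for i
      proof -
        have "k * a i \<noteq> 0"
        proof
          assume "k * a i = 0"
          moreover have "gcd 0 (int m) = int m" by simp
          ultimately have "int m = gcd (a i) (int m)" using gcd_k[of i] by metis
          then have "int m dvd a i" by (metis gcd_dvd1)
          then show False using that d(1) by (meson dvd_trans int_dvd_int_iff)
        qed
        then show ?thesis by auto
      qed
      then show "d \<le> (\<Sum>i | i \<in> I \<and> \<not> int d dvd a i. card (?A i) - 1) + 1"
        using assms(4)[OF d] by simp
    qed (use assms in auto)
    then show ?thesis by (auto simp: sums_mod_def)
  qed
  obtain I' where I': "I' \<subseteq> I" "sums_mod m I' ?A = sums_mod m I ?A"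
    "card I' < residue_count (int m) (sums_mod m I ?A)"
    using sums_mod_generating_subset[of I m ?A] assms by auto
  have "residue_count (int m) (sums_mod m I ?A) \<le> card {0..<int m}"
    unfolding residue_count_def by (rule card_mono) auto
  then have "card I' < m" using I'(3) by simp
  moreover have "\<exists>F\<subseteq>I'. [t = (\<Sum>i\<in>F. k * a i)] (mod int m)" for t
    using full[of t] I'(2) sums_mod_two_point[OF finite_subset[OF I'(1) assms(1)], of t m "\<lambda>i. k * a i"] by simp
  ultimately show ?thesis using I'(1) by blast
qed

section \<open>Zero-sum subsets of integers\<close>

text \<open>Pigeonhole on the \<open>m + 1\<close> partial sums along an enumeration: two of them
  agree modulo \<open>m\<close>, and the segment between them is the subset.\<close>

lemma nonempty_zero_sum_subset:
  fixes a :: "'i \<Rightarrow> int"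
  assumes "finite I" "m \<ge> 1" "card I \<ge> m"
  shows "\<exists>J\<subseteq>I. J \<noteq> {} \<and> int m dvd (\<Sum>i\<in>J. a i)"
proof -
  obtain xs where xs: "set xs = I" "distinct xs" using finite_distinct_list[OF assms(1)] by blast
  have len: "length xs \<ge> m" using xs assms(3) distinct_card by fastforce
  define s where "s k = (\<Sum>i<k. a (xs ! i))" for k
  have "(\<lambda>k. s k mod int m) ` {..m} \<subseteq> {0..<int m}" using assms(2) by auto
  then have "card ((\<lambda>k. s k mod int m) ` {..m}) \<le> m"
    using card_mono[of "{0..<int m}"] by fastforce
  then have "\<not> inj_on (\<lambda>k. s k mod int m) {..m}"
    using card_image by fastforce
  then obtain j k where jk: "j < k" "k \<le> m" "s j mod int m = s k mod int m"
    unfolding inj_on_def by (metis atMost_iff linorder_neqE_nat)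
  have inj: "inj_on ((!) xs) {j..<k}"
    using xs len jk by (auto simp: inj_on_def nth_eq_iff_index_eq)
  have "(\<Sum>i\<in>(!) xs ` {j..<k}. a i) = (\<Sum>i\<in>{j..<k}. a (xs ! i))"
    using inj by (simp add: sum.reindex)
  also have "\<dots> = s k - s j"
    using jk sum_diff_nat_ivl[of 0 j k "\<lambda>i. a (xs ! i)"] by (simp add: s_def atLeast0LessThan)
  finally have "int m dvd (\<Sum>i\<in>(!) xs ` {j..<k}. a i)"
    using jk(3) by (simp add: mod_eq_dvd_iff[symmetric])
  moreover have "(!) xs ` {j..<k} \<subseteq> I" using xs len jk by auto
  ultimately show ?thesis using jk by (intro exI[of _ "(!) xs ` {j..<k}"]) auto
qed

text \<open>Greedy extraction. Each block is named by one of its own elements, so the family is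
  indexed inside \<open>I\<close>. The last extraction happens with only \<open>k - 1\<close> blocks
  removed, which explains the \<open>+ b\<close> in the size hypothesis.\<close>

lemma disjoint_blocks:
  fixes P :: "'i set \<Rightarrow> bool"
  assumes "finite I" "b \<ge> 1"
    and "\<And>E. E \<subseteq> I \<Longrightarrow> card E \<ge> N \<Longrightarrow> \<exists>B\<subseteq>E. card B = b \<and> P B"
    and "card I + b \<ge> k * b + N"
  shows "\<exists>R B. R \<subseteq> I \<and> card R = k \<and> (\<forall>i\<in>R. i \<in> B i \<and> B i \<subseteq> I \<and> card (B i) = b \<and> P (B i))
    \<and> (\<forall>i\<in>R. \<forall>j\<in>R. i \<noteq> j \<longrightarrow> B i \<inter> B j = {})"
  using assms(1,3,4)
proof (induction k arbitrary: I)
  case 0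
  then show ?case by (intro exI[of _ "{}"]) auto
next
  case (Suc k)
  have "card I \<ge> N" using Suc.prems(3) by simp
  then obtain C where C: "C \<subseteq> I" "card C = b" "P C" using Suc.prems(2)[of I] by blast
  then have finC: "finite C" and Cne: "C \<noteq> {}"
    using assms(2) Suc.prems(1) finite_subset by auto
  have "card (I - C) = card I - b" using C finC by (simp add: card_Diff_subset)
  then have "\<exists>R B. R \<subseteq> I - C \<and> card R = k \<and> (\<forall>i\<in>R. i \<in> B i \<and> B i \<subseteq> I - C \<and> card (B i) = b \<and> P (B i))
    \<and> (\<forall>i\<in>R. \<forall>j\<in>R. i \<noteq> j \<longrightarrow> B i \<inter> B j = {})"
    using Suc.prems(1,3) by (intro Suc.IH) (auto intro!: Suc.prems(2))
  then obtain R B where RB: "R \<subseteq> I - C" "card R = k"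
    "\<forall>i\<in>R. i \<in> B i \<and> B i \<subseteq> I - C \<and> card (B i) = b \<and> P (B i)"
    "\<forall>i\<in>R. \<forall>j\<in>R. i \<noteq> j \<longrightarrow> B i \<inter> B j = {}" by (elim exE conjE)
  obtain c where c: "c \<in> C" using Cne by blast
  have cR: "c \<notin> R" using RB(1) c by blast
  have finR: "finite R" using RB(1) Suc.prems(1) finite_subset by blast
  show ?case
  proof (intro exI[of _ "insert c R"] exI[of _ "B(c := C)"] conjI ballI impI)
    show "insert c R \<subseteq> I" using RB(1) C c by blast
    show "card (insert c R) = Suc k" using finR cR RB(2) by simp
  next
    fix i j assume "i \<in> insert c R" "j \<in> insert c R" "i \<noteq> j"
    then show "(B(c := C)) i \<inter> (B(c := C)) j = {}"
      using RB(3,4) by (auto 0 4)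
  qed (use RB C c cR in auto)
qed

text \<open>Sort by residue and compare terms \<open>q - 1\<close> places apart. If two of these
  agree, the \<open>q\<close> terms from one to the other are all congruent. Otherwise the
  \<open>q - 1\<close> differences are nonzero, their subset sums cover Z/q, and swapping partners
  corrects the sum of one term per pair plus one unpaired term.\<close>

lemma erdos_ginzburg_ziv_prime:
  fixes a :: "'i \<Rightarrow> int"
  assumes "Factorial_Ring.prime q" "finite I" "card I \<ge> 2 * q - 1"
  shows "\<exists>J\<subseteq>I. card J = q \<and> int q dvd (\<Sum>i\<in>J. a i)"
proof -
  let ?key = "\<lambda>i. a i mod int q"
  have q: "q > 1" using assms(1) by (rule prime_gt_1_nat)
  obtain xs where xs: "set xs = I" "distinct xs" using finite_distinct_list[OF assms(2)] by blast
  define ys where "ys = sort_key ?key xs"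
  have ys: "set ys = I" "distinct ys" "sorted (map ?key ys)" using xs by (auto simp: ys_def)
  have len: "length ys \<ge> 2 * q - 1" using ys assms(3) distinct_card by fastforce
  show ?thesis
  proof (cases "\<exists>i<q-1. ?key (ys ! i) = ?key (ys ! (i + (q - 1)))")
    case True
    then obtain i where i: "i < q - 1" "?key (ys ! i) = ?key (ys ! (i + (q - 1)))" by blast
    have key: "?key (ys ! j) = ?key (ys ! i)" if "j \<in> {i..<i + q}" for j
    proof -
      have j: "i \<le> j" "j \<le> i + (q - 1)" "i + (q - 1) < length ys" using that len i by auto
      then have "map ?key ys ! i \<le> map ?key ys ! j" "map ?key ys ! j \<le> map ?key ys ! (i + (q - 1))"
        by (intro sorted_nth_mono[OF ys(3)]; simp)+
      then have "?key (ys ! i) \<le> ?key (ys ! j)" "?key (ys ! j) \<le> ?key (ys ! (i + (q - 1)))"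
        using j by (simp_all add: nth_map)
      then show ?thesis using i by simp
    qed
    let ?J = "(!) ys ` {i..<i + q}"
    have inj: "inj_on ((!) ys) {i..<i + q}"
      using ys len i by (auto simp: inj_on_def nth_eq_iff_index_eq)
    have "[(\<Sum>j\<in>{i..<i + q}. a (ys ! j)) = (\<Sum>j\<in>{i..<i + q}. a (ys ! i))] (mod int q)"
      by (rule cong_sum) (unfold cong_def, rule key)
    then have "[(\<Sum>j\<in>?J. a j) = int q * a (ys ! i)] (mod int q)"
      using inj by (simp add: sum.reindex)
    then have "int q dvd (\<Sum>j\<in>?J. a j)" by (simp add: cong_dvd_iff)
    moreover have "?J \<subseteq> I" using ys(1) len i by auto
    ultimately show ?thesis using card_image[OF inj] by (intro exI[of _ ?J]) simp
  next
    case False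
    define \<delta> where "\<delta> i = a (ys ! (i + (q - 1))) - a (ys ! i)" for i
    have nd: "\<not> int q dvd \<delta> i" if "i < q - 1" for i
      using False that by (metis \<delta>_def mod_eq_dvd_iff)
    have "\<exists>I'\<subseteq>{..<q - 1}. card I' < q \<and> (\<forall>t. \<exists>F\<subseteq>I'. [t = (\<Sum>i\<in>F. 1 * \<delta> i)] (mod int q))"
    proof (rule subset_sums_cover)
      fix d assume "d dvd q" "d > 1"
      then have "d = q" using assms(1) prime_nat_iff by auto
      moreover have "{i \<in> {..<q - 1}. \<not> int q dvd \<delta> i} = {..<q - 1}" using nd by auto
      ultimately show "d \<le> card {i \<in> {..<q - 1}. \<not> int d dvd \<delta> i} + 1" by simp
    qed (use q in auto)
    then obtain F where F: "F \<subseteq> {..<q - 1}"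
      "[- (\<Sum>i<q - 1. a (ys ! i)) - a (ys ! (2 * q - 2)) = (\<Sum>i\<in>F. \<delta> i)] (mod int q)"
      by (metis (no_types, lifting) mult_1 subset_trans sum.cong)
    \<comment> \<open>Indices in \<open>F\<close> move to their partner. Position
      \<open>q - 1\<close> is sent to \<open>2 * q - 2\<close>, the unpaired term among the first
      \<open>2 * q - 1\<close>.\<close>
    define idx where "idx i = (if i \<in> insert (q - 1) F then i + (q - 1) else i)" for i
    have idx: "inj_on idx {..<q}" "idx i < 2 * q - 1" if "i < q" for i
      using that by (auto simp: inj_on_def idx_def split: if_splits)
    have inj: "inj_on (\<lambda>i. ys ! idx i) {..<q}"
    proof (rule inj_onI)
      fix i j assume ij: "i \<in> {..<q}" "j \<in> {..<q}" "ys ! idx i = ys ! idx j"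
      then have "idx i = idx j"
        using ys(2) len idx(2)[of i] idx(2)[of j] by (simp add: nth_eq_iff_index_eq)
      then show "i = j" using idx(1)[of 0] ij by (auto simp: inj_on_def)
    qed
    let ?J = "(\<lambda>i. ys ! idx i) ` {..<q}"
    have "(\<Sum>i\<in>?J. a i) = (\<Sum>i<q. a (ys ! idx i))"
      using inj by (simp add: sum.reindex)
    also have "\<dots> = (\<Sum>i<q - 1. a (ys ! idx i)) + a (ys ! idx (q - 1))"
      using q sum.lessThan_Suc[of "\<lambda>i. a (ys ! idx i)" "q - 1"] by simp
    also have "idx (q - 1) = 2 * q - 2" by (simp add: idx_def)
    also have "(\<Sum>i<q - 1. a (ys ! idx i)) = (\<Sum>i<q - 1. a (ys ! i) + (if i \<in> F then \<delta> i else 0))"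
      by (rule sum.cong) (auto simp: idx_def \<delta>_def)
    also have "\<dots> = (\<Sum>i<q - 1. a (ys ! i)) + (\<Sum>i\<in>F. \<delta> i)"
      using F(1) by (simp add: sum.distrib sum.If_cases inf.absorb2)
    finally have "int q dvd (\<Sum>i\<in>?J. a i)"
      using cong_sym[OF F(2)] by (simp add: cong_iff_dvd_diff algebra_simps)
    moreover have "?J \<subseteq> I" using ys(1) len idx(2) by fastforce
    ultimately show ?thesis using card_image[OF inj] by (intro exI[of _ ?J]) simp
  qed
qed

text \<open>Multiplicative induction for m = q n: 2n - 1 disjoint blocks of length \<open>q\<close>
  have sums divisible by \<open>q\<close>, and the quotients of these sums are treated modulo
  \<open>n\<close>. With 2q - 1 terms needed for the last block, exactly 2m - 1 terms
  suffice.\<close>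

theorem erdos_ginzburg_ziv:
  fixes a :: "'i \<Rightarrow> int"
  assumes "m \<ge> 1" "finite I" "card I \<ge> 2 * m - 1"
  shows "\<exists>J\<subseteq>I. card J = m \<and> int m dvd (\<Sum>i\<in>J. a i)"
  using assms
proof (induction m arbitrary: I a rule: less_induct)
  case (less m)
  show ?case
  proof (cases "m = 1")
    case True
    then obtain i where "i \<in> I" using less.prems by fastforce
    then show ?thesis using True by (intro exI[of _ "{i}"]) auto
  next
    case False
    then obtain q where q: "Factorial_Ring.prime q" "q dvd m" using prime_factor_nat by blast
    then obtain n where n: "m = q * n" by blast
    have q1: "q > 1" using q prime_gt_1_nat by blast
    have n0: "n \<ge> 1" using less.prems n by (cases n) auto
    have "n < m" using n q1 n0 by simp
    have "\<exists>R B. R \<subseteq> I \<and> card R = 2 * n - 1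
      \<and> (\<forall>i\<in>R. i \<in> B i \<and> B i \<subseteq> I \<and> card (B i) = q \<and> int q dvd (\<Sum>j\<in>B i. a j))
      \<and> (\<forall>i\<in>R. \<forall>j\<in>R. i \<noteq> j \<longrightarrow> B i \<inter> B j = {})"
    proof (rule disjoint_blocks[where N = "2 * q - 1"])
      fix E assume "E \<subseteq> I" "card E \<ge> 2 * q - 1"
      then show "\<exists>B\<subseteq>E. card B = q \<and> int q dvd (\<Sum>j\<in>B. a j)"
        using erdos_ginzburg_ziv_prime[OF q(1)] less.prems finite_subset by metis
    next
      have "(2 * n - 1) * q + (2 * q - 1) = (2 * m - 1) + q"
      proof -
        obtain n' where "n = Suc n'" using n0 by (cases n) auto
        then show ?thesis using n q1 by (simp add: algebra_simps)
      qed
      then show "(2 * n - 1) * q + (2 * q - 1) \<le> card I + q" using less.prems by simp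
    qed (use less.prems q1 in auto)
    then obtain R B where R: "R \<subseteq> I" "card R = 2 * n - 1"
      and B: "\<And>i. i \<in> R \<Longrightarrow> B i \<subseteq> I \<and> card (B i) = q \<and> int q dvd (\<Sum>j\<in>B i. a j)"
      and disj: "\<And>i j. i \<in> R \<Longrightarrow> j \<in> R \<Longrightarrow> i \<noteq> j \<Longrightarrow> B i \<inter> B j = {}" by metis
    have finR: "finite R" using R less.prems finite_subset by blast
    obtain J where J: "J \<subseteq> R" "card J = n" "int n dvd (\<Sum>i\<in>J. (\<Sum>j\<in>B i. a j) div int q)"
      using less.IH[OF \<open>n < m\<close> n0 finR, of "\<lambda>i. (\<Sum>j\<in>B i. a j) div int q"] R by auto
    let ?K = "\<Union>i\<in>J. B i"
    have fin: "finite J" "\<forall>i\<in>J. finite (B i)" "\<forall>i\<in>J. \<forall>j\<in>J. i \<noteq> j \<longrightarrow> B i \<inter> B j = {}"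
    proof -
      show "finite J" using J(1) finR finite_subset by blast
      show "\<forall>i\<in>J. finite (B i)"
        using J(1) finite_subset[OF _ less.prems(2)] B by (meson subsetD)
      show "\<forall>i\<in>J. \<forall>j\<in>J. i \<noteq> j \<longrightarrow> B i \<inter> B j = {}" using J(1) disj by blast
    qed
    have "card ?K = (\<Sum>i\<in>J. card (B i))" using fin by (intro card_UN_disjoint) auto
    also have "\<dots> = m" using J B n by (simp add: subset_iff)
    finally have "card ?K = m" .
    moreover have "(\<Sum>j\<in>?K. a j) = (\<Sum>i\<in>J. \<Sum>j\<in>B i. a j)"
      using fin by (intro sum.UNION_disjoint) auto
    moreover have "\<dots> = (\<Sum>i\<in>J. int q * ((\<Sum>j\<in>B i. a j) div int q))"
      using J B by (intro sum.cong) auto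
    moreover have "\<dots> = int q * (\<Sum>i\<in>J. (\<Sum>j\<in>B i. a j) div int q)"
      by (simp add: sum_distrib_left)
    ultimately have "card ?K = m" "int m dvd (\<Sum>j\<in>?K. a j)"
      using J(3) n by simp_all
    moreover have "?K \<subseteq> I" using J B by blast
    ultimately show ?thesis by blast
  qed
qed

text \<open>Blocks of length \<open>m\<close> are split off one after another; only the last one
  needs the full reserve of 2m - 1 terms.\<close>

lemma erdos_ginzburg_ziv_multiple:
  fixes a :: "'i \<Rightarrow> int"
  assumes "m \<ge> 1" "finite I" "card I + 1 \<ge> k * m + m"
  shows "\<exists>J\<subseteq>I. card J = k * m \<and> int m dvd (\<Sum>i\<in>J. a i)"
proof -
  have "\<exists>R B. R \<subseteq> I \<and> card R = k
      \<and> (\<forall>i\<in>R. i \<in> B i \<and> B i \<subseteq> I \<and> card (B i) = m \<and> int m dvd (\<Sum>j\<in>B i. a j))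
      \<and> (\<forall>i\<in>R. \<forall>j\<in>R. i \<noteq> j \<longrightarrow> B i \<inter> B j = {})"
  proof (rule disjoint_blocks[where N = "2 * m - 1"])
    fix E assume "E \<subseteq> I" "card E \<ge> 2 * m - 1"
    then show "\<exists>B\<subseteq>E. card B = m \<and> int m dvd (\<Sum>j\<in>B. a j)"
      using erdos_ginzburg_ziv[OF assms(1)] assms finite_subset by metis
  qed (use assms in auto)
  then obtain R B where R: "R \<subseteq> I" "card R = k"
    and B: "\<And>i. i \<in> R \<Longrightarrow> B i \<subseteq> I \<and> card (B i) = m \<and> int m dvd (\<Sum>j\<in>B i. a j)"
    and disj: "\<And>i j. i \<in> R \<Longrightarrow> j \<in> R \<Longrightarrow> i \<noteq> j \<Longrightarrow> B i \<inter> B j = {}" by metis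
  let ?K = "\<Union>i\<in>R. B i"
  have fin: "finite R" "\<forall>i\<in>R. finite (B i)" "\<forall>i\<in>R. \<forall>j\<in>R. i \<noteq> j \<longrightarrow> B i \<inter> B j = {}"
  proof -
    show "finite R" using R(1) assms(2) finite_subset by blast
    show "\<forall>i\<in>R. finite (B i)" using finite_subset[OF _ assms(2)] B by meson
    show "\<forall>i\<in>R. \<forall>j\<in>R. i \<noteq> j \<longrightarrow> B i \<inter> B j = {}" using disj by blast
  qed
  have "card ?K = (\<Sum>i\<in>R. card (B i))" using fin by (intro card_UN_disjoint) auto
  then have "card ?K = k * m" using R B by simp
  moreover have "(\<Sum>j\<in>?K. a j) = (\<Sum>i\<in>R. \<Sum>j\<in>B i. a j)"
    using fin by (intro sum.UNION_disjoint) auto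
  then have "int m dvd (\<Sum>j\<in>?K. a j)" using B by (simp add: dvd_sum)
  moreover have "?K \<subseteq> I" using B by blast
  ultimately show ?thesis by blast
qed

text \<open>After division by \<open>d\<close> the modulus is \<open>e\<close>, and k m is a
  multiple of \<open>e\<close>. So only \<open>e - 1\<close> terms beyond k m are spent, instead of
  \<open>m - 1\<close>.\<close>

lemma erdos_ginzburg_ziv_divisible:
  fixes a :: "'i \<Rightarrow> int"
  assumes "m = d * e" "m \<ge> 1" "finite I" "\<And>i. i \<in> I \<Longrightarrow> int d dvd a i" "card I + 1 \<ge> k * m + e"
  shows "\<exists>J\<subseteq>I. card J = k * m \<and> int m dvd (\<Sum>i\<in>J. a i)"
proof -
  have "e \<ge> 1" using assms(1,2) by (cases e) auto
  moreover have "card I + 1 \<ge> (k * d) * e + e" using assms(1,5) by (simp add: algebra_simps)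
  ultimately obtain J where J: "J \<subseteq> I" "card J = (k * d) * e" "int e dvd (\<Sum>i\<in>J. a i div int d)"
    using erdos_ginzburg_ziv_multiple[OF _ assms(3)] by metis
  have "(\<Sum>i\<in>J. a i) = (\<Sum>i\<in>J. int d * (a i div int d))"
    using J assms(4) by (intro sum.cong) auto
  then have "int m dvd (\<Sum>i\<in>J. a i)"
    using J(3) assms(1) by (simp add: sum_distrib_left[symmetric])
  then show ?thesis using J assms(1) by (intro exI[of _ J]) (auto simp: algebra_simps)
qed

section \<open>Orderings of sequences\<close>

locale fixed_point_free_action =
  fixes p m :: nat and r :: int
  assumes prime_p: "Factorial_Ring.prime p"
    and m_pos: "m \<ge> 1"
    and r_pow_p: "[r ^ p = 1] (mod int m)"
    and coprime_r_diff: "coprime (r - 1) (int m)"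
begin

lemma p_gt_1: "p > 1"
  using prime_p by (rule prime_gt_1_nat)

lemma coprime_r_pow: "coprime (r ^ k) (int m)"
proof -
  have "coprime (r ^ p) (int m)"
    using r_pow_p by (metis cong_imp_coprime cong_sym coprime_1_left)
  then show ?thesis using p_gt_1 by (simp add: coprime_power_left_iff)
qed

lemma r_pow_cong:
  assumes "[i = j] (mod p)"
  shows "[r ^ i = r ^ j] (mod int m)"
proof -
  have "[r ^ k = r ^ (k mod p)] (mod int m)" for k
  proof -
    have "r ^ k = (r ^ p) ^ (k div p) * r ^ (k mod p)"
      by (metis mult_div_mod_eq power_add power_mult)
    moreover have "[(r ^ p) ^ (k div p) * r ^ (k mod p) = 1 ^ (k div p) * r ^ (k mod p)] (mod int m)"
      by (intro cong_mult cong_pow r_pow_p) simp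
    ultimately show ?thesis by simp
  qed
  then show ?thesis using assms by (metis cong_def)
qed

text \<open>The order of \<open>r\<close> modulo \<open>g\<close> divides both \<open>p\<close> and
  \<open>k\<close>, hence is 1; an inverse of \<open>k\<close> modulo \<open>p\<close> makes this
  explicit.\<close>

lemma r_cong_1:
  assumes "[r ^ k = 1] (mod g)" "g dvd int m" "\<not> p dvd k"
  shows "[r = 1] (mod g)"
proof -
  have "coprime k p" using assms(3) prime_p by (metis coprime_commute prime_imp_coprime)
  then obtain x where x: "[k * x = 1] (mod p)" using cong_solve_coprime_nat by auto
  have "[r ^ (k * x) = r ^ 1] (mod int m)" using r_pow_cong[OF x] .
  then have "[r ^ (k * x) = r] (mod g)" using assms(2) by (simp add: cong_dvd_modulus)
  moreover have "[r ^ (k * x) = 1] (mod g)"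
    using cong_pow[OF assms(1), of x] by (simp add: power_mult)
  ultimately show ?thesis using cong_sym cong_trans by blast
qed

text \<open>Up to a unit the difference is r^k - 1 with \<open>k\<close> prime to \<open>p\<close>,
  and a common divisor of that with \<open>m\<close> would divide r - 1 by
  \<open>r_cong_1\<close>.\<close>

lemma coprime_r_pow_diff:
  assumes "\<not> [i = j] (mod p)"
  shows "coprime (r ^ i - r ^ j) (int m)"
proof -
  have *: "coprime (r ^ i - r ^ j) (int m)" if "i < j" "\<not> [i = j] (mod p)" for i j
  proof -
    define k where "k = j - i"
    have j: "j = i + k" using that by (simp add: k_def)
    have "\<not> p dvd k" using that(2) j by (metis add.right_neutral cong_add_lcancel_nat cong_0_iff cong_sym)
    define g where "g = gcd (r ^ k - 1) (int m)"
    have "g dvd r ^ k - 1" "g dvd int m" by (simp_all add: g_def)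
    then have "[r = 1] (mod g)" using r_cong_1 \<open>\<not> p dvd k\<close> by (simp add: cong_iff_dvd_diff)
    then have "g dvd r - 1" by (simp add: cong_iff_dvd_diff)
    then have "is_unit g" using coprime_r_diff \<open>g dvd int m\<close> coprime_common_divisor by blast
    then have "coprime (r ^ k - 1) (int m)" by (simp add: g_def coprime_iff_gcd_eq_1)
    moreover have "r ^ i - r ^ j = - (r ^ i * (r ^ k - 1))" by (simp add: j power_add algebra_simps)
    ultimately show ?thesis using coprime_r_pow by simp
  qed
  have "i \<noteq> j" using assms by auto
  then show ?thesis
    using *[of i j] *[of j i] assms cong_sym
    by (metis coprime_minus_left_iff linorder_neqE_nat minus_diff_eq)
qed

text \<open>For a prime factor \<open>q\<close> of \<open>m\<close>, Fermat gives r^(q-1) = 1 modulo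
  \<open>q\<close>. Since \<open>r\<close> is not 1 there, \<open>p\<close> divides q - 1; other
  divisors are products of such primes.\<close>

lemma divisor_cong_1:
  assumes "d dvd m"
  shows "[d = 1] (mod p)"
  using assms
proof (induction d rule: less_induct)
  case (less d)
  show ?case
  proof (cases "d = 1")
    case False
    then obtain q where q: "Factorial_Ring.prime q" "q dvd d" using prime_factor_nat by blast
    then obtain d' where d': "d = q * d'" by blast
    have "d \<noteq> 0" using less.prems m_pos by auto
    then have "d' < d" using d' q prime_gt_1_nat by auto
    have IH: "[d' = 1] (mod p)" using less.IH[OF \<open>d' < d\<close>] less.prems d' by (metis dvd_mult_right)
    have qm: "int q dvd int m" using q less.prems by (meson dvd_trans int_dvd_int_iff)
    have q1: "q > 1" using q prime_gt_1_nat by blast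
    define a where "a = nat (r mod int q)"
    have a: "int a = r mod int q" using q1 by (simp add: a_def)
    have ra: "[int a = r] (mod int q)" using a by (simp add: cong_def)
    have "\<not> q dvd a"
    proof
      assume "q dvd a"
      then have "int q dvd r" using a by (metis dvd_mod_imp_dvd dvd_refl int_dvd_int_iff)
      then have "is_unit (int q)" using coprime_r_pow[of 1] qm coprime_common_divisor by fastforce
      then show False using q1 by simp
    qed
    then have "[a ^ (q - 1) = 1] (mod q)" using fermat_theorem q(1) by blast
    then have "[int a ^ (q - 1) = 1] (mod int q)" by (metis cong_int_iff of_nat_1 of_nat_power)
    then have rq: "[r ^ (q - 1) = 1] (mod int q)"
      using cong_pow[OF ra, of "q - 1"] cong_sym cong_trans by blast
    have "p dvd q - 1"
    proof (rule ccontr)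
      assume "\<not> p dvd q - 1"
      then have "[r = 1] (mod int q)" using r_cong_1[OF rq qm] by blast
      then have "is_unit (int q)"
        using coprime_r_diff qm coprime_common_divisor by (metis cong_iff_dvd_diff)
      then show False using q1 by simp
    qed
    then have "[q = 1] (mod p)" using q1 by (simp add: cong_altdef_nat)
    then show ?thesis using cong_mult[OF _ IH] d' by fastforce
  qed simp
qed

text \<open>Write d = 1 + k p with k > 0. For odd \<open>p\<close> and k = 1 the divisor would be
  even, but 2 is not 1 modulo \<open>p\<close>.\<close>

lemma divisor_large:
  assumes "d dvd m" "d > 1"
  shows "d \<ge> 2 * p - 1" "odd p \<Longrightarrow> d \<ge> 2 * p + 1"
proof -
  obtain k where k: "d = 1 + k * p"
    using divisor_cong_1[OF assms(1)] assms(2)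
    by (metis add.commute cong_le_nat less_imp_le_nat)
  have "k \<noteq> 0" using k assms(2) by auto
  have odd: "d \<ge> 2 * p + 1" if "odd p"
  proof -
    have "k \<noteq> 1"
    proof
      assume "k = 1"
      then have "2 dvd m" using k that assms(1) by (simp, meson dvd_trans even_Suc)
      then have "[2 = 1] (mod p)" by (rule divisor_cong_1)
      then have "p dvd 2 - 1" using cong_altdef_nat[of 1 2 p] by simp
      then show False using p_gt_1 by simp
    qed
    then have "k \<ge> 2" using \<open>k \<noteq> 0\<close> by simp
    then have "2 * p \<le> k * p" by (rule mult_le_mono1)
    then show ?thesis using k by simp
  qed
  then show "odd p \<Longrightarrow> d \<ge> 2 * p + 1" .
  show "d \<ge> 2 * p - 1"
  proof (cases "odd p")
    case False
    then have "p = 2" using prime_p prime_odd_nat[of p] p_gt_1 by linarith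
    then show ?thesis using k \<open>k \<noteq> 0\<close> by simp
  qed (use odd in simp)
qed

lemma p_dvd_m_minus_1: "p dvd m - 1"
  using divisor_cong_1[of m] m_pos by (simp add: cong_altdef_nat)

text \<open>Both factors are at least 2p - 1, so (d - p)(e - p) >= (p - 1)^2; expanding with d e = q
  p + 1 gives d + e <= q + 2.\<close>

lemma divisor_pair_bound:
  assumes "m = d * e" "d > 1" "e > 1"
  shows "d + e \<le> (m - 1) div p + 2"
proof -
  define q where "q = (m - 1) div p"
  have q: "m = q * p + 1" using p_dvd_m_minus_1 m_pos by (simp add: q_def)
  have "d \<ge> 2 * p - 1" "e \<ge> 2 * p - 1"
    using divisor_large(1)[of d] divisor_large(1)[of e] assms by auto
  obtain p' where p': "p = Suc p'" using p_gt_1 by (cases p) auto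
  have "2 * p' + 1 \<le> d" "2 * p' + 1 \<le> e" using \<open>d \<ge> 2 * p - 1\<close> \<open>e \<ge> 2 * p - 1\<close> p' by auto
  then obtain x y where x: "d = 2 * p' + 1 + x" and y: "e = 2 * p' + 1 + y" using le_Suc_ex by metis
  have "p * (d + e) + 1 \<le> d * e + 2 * p"
    unfolding p' x y by (simp add: algebra_simps)
  also have "\<dots> = p * (q + 2) + 1" using assms(1) q by (simp add: algebra_simps)
  finally have "p * (d + e) \<le> p * (q + 2)" by simp
  then have "d + e \<le> q + 2" using p_gt_1 mult_le_cancel1[of p "d + e" "q + 2"] by simp
  then show ?thesis by (simp add: q_def)
qed

lemma gcd_orbit:
  "gcd (r ^ j * a) (int m) = gcd a (int m)"
  "i \<noteq> j \<Longrightarrow> i < p \<Longrightarrow> j < p \<Longrightarrow> gcd (r ^ i * a - r ^ j * a) (int m) = gcd a (int m)"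
proof -
  show "gcd (r ^ j * a) (int m) = gcd a (int m)"
    using coprime_r_pow[of j] by (metis coprime_commute gcd_mult_left_left_cancel)
  assume "i \<noteq> j" "i < p" "j < p"
  then have "coprime (r ^ i - r ^ j) (int m)" by (intro coprime_r_pow_diff) (simp add: cong_def)
  moreover have "r ^ i * a - r ^ j * a = (r ^ i - r ^ j) * a" by (simp add: algebra_simps)
  ultimately show "gcd (r ^ i * a - r ^ j * a) (int m) = gcd a (int m)"
    by (metis coprime_commute gcd_mult_left_left_cancel)
qed

text \<open>All differences are \<open>a\<close> times a unit modulo \<open>m\<close>, which makes
  zero together with a part of the orbit an admissible summand for
  \<open>sums_cover\<close>.\<close>

lemma orbit_gap:
  assumes "J \<subseteq> {..<p}" "u \<in> insert 0 ((\<lambda>j. r ^ j * a) ` J)" "v \<in> insert 0 ((\<lambda>j. r ^ j * a) ` J)" "u \<noteq> v"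
  shows "gcd (u - v) (int m) = gcd a (int m)"
proof (cases "u = 0 \<or> v = 0")
  case True
  then show ?thesis using assms gcd_orbit(1) by auto
next
  case False
  then obtain i j where "i \<in> J" "j \<in> J" "u = r ^ i * a" "v = r ^ j * a" using assms by auto
  moreover from this have "i \<noteq> j" using assms(4) by auto
  ultimately show ?thesis using gcd_orbit(2)[of i j a] assms(1) by auto
qed

lemma orbit_card:
  assumes "J \<subseteq> {..<p}" "\<not> int m dvd a"
  shows "card (insert 0 ((\<lambda>j. r ^ j * a) ` J)) - 1 = card J"
proof -
  have fin: "finite J" using assms(1) finite_subset by blast
  have ne: "gcd a (int m) \<noteq> int m" using assms(2) by (metis gcd_dvd1)
  have "0 \<notin> (\<lambda>j. r ^ j * a) ` J"
  proof
    assume "0 \<in> (\<lambda>j. r ^ j * a) ` J"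
    then obtain j where "r ^ j * a = 0" by auto
    then have "gcd (r ^ j * a) (int m) = gcd 0 (int m)" by (simp only:)
    then show False using gcd_orbit(1)[of j a] ne by simp
  qed
  moreover have "inj_on (\<lambda>j. r ^ j * a) J"
  proof (rule inj_onI, rule ccontr)
    fix i j assume ij: "i \<in> J" "j \<in> J" "r ^ i * a = r ^ j * a" "i \<noteq> j"
    then have "gcd (r ^ i * a - r ^ j * a) (int m) = gcd 0 (int m)" by (simp only: diff_self)
    then show False using gcd_orbit(2)[of i j a] ij assms(1) ne by auto
  qed
  ultimately show ?thesis using fin by (simp add: card_image)
qed

text \<open>In the last case below almost all exponents vanish: the blocks in \<open>F\<close> must be chosen to reach
  the right number, while those in \<open>P\<close> may be exchanged for blocks with exponent \<open>0\<close> and therefore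
  gain \<open>p\<close> instead of \<open>p - 1\<close>.\<close>

lemma block_selection:
  fixes a :: "'j \<Rightarrow> int"
  assumes fin: "finite R" and card_R: "card R = (m - 1) + (m - 1) div p"
  shows "(\<exists>T\<subseteq>R. card T = m \<and> int m dvd (\<Sum>i\<in>T. a i))
    \<or> (\<exists>T\<subseteq>R. \<exists>e. card T = m - 1 \<and> int m dvd w + (\<Sum>i\<in>T. r ^ e i * a i))"
proof -
  define q where "q = (m - 1) div p"
  have q: "m = q * p + 1" using p_dvd_m_minus_1 m_pos by (simp add: q_def)
  define out where "out d = {i \<in> R. \<not> int d dvd a i}" for d
  have fin_out: "finite (out d)" for d using fin by (simp add: out_def)
  define Z where "Z = {i \<in> R. int m dvd a i}"
  have ZR: "Z \<subseteq> R" "finite Z" "R - Z = out m" using fin by (auto simp: Z_def out_def)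
  have card_Z: "card Z + card (out m) = (m - 1) + q"
    using card_R ZR by (metis card_Diff_subset card_mono fin le_add_diff_inverse q_def)
  \<comment> \<open>Two-point sets gain 1 each, so covering asks for d - 1 exponents outside dZ for
    each divisor d > 1. Failure at a proper divisor and failure at \<open>m\<close> alone need
    different remedies.\<close>
  consider (proper) d where "d dvd m" "d > 1" "d \<noteq> m" "card (out d) + 2 \<le> d"
    | (dense) "\<And>d. d dvd m \<Longrightarrow> d > 1 \<Longrightarrow> d \<le> card (out d) + 1"
    | (only) "\<And>d. d dvd m \<Longrightarrow> d > 1 \<Longrightarrow> d \<noteq> m \<Longrightarrow> d \<le> card (out d) + 1" "card (out m) + 2 \<le> m"
    by fastforce
  then show ?thesis
  proof cases
    case proper
    obtain e where e: "m = d * e" using proper(1) by blast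
    have "e \<noteq> 0" using e m_pos by (cases e) auto
    then have "e > 1" using e proper(3) by (cases "e = 1") auto
    define Rd where "Rd = {i \<in> R. int d dvd a i}"
    have "R - Rd = out d" "Rd \<subseteq> R" by (auto simp: Rd_def out_def)
    then have "card R = card Rd + card (out d)"
      using fin by (metis card_Diff_subset card_mono finite_subset le_add_diff_inverse)
    \<comment> \<open>There are m - 1 + q exponents, at most d - 2 of them are lost, and d + e <= q
      + 2.\<close>
    then have "card Rd + 1 \<ge> 1 * m + e"
      using divisor_pair_bound[OF e proper(2) \<open>e > 1\<close>] card_R proper(4) m_pos by simp
    then have "\<exists>T\<subseteq>Rd. card T = 1 * m \<and> int m dvd (\<Sum>i\<in>T. a i)"
      by (rule erdos_ginzburg_ziv_divisible[OF e m_pos, rotated -1]) (use fin in \<open>simp_all add: Rd_def\<close>)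
    then obtain T where "T \<subseteq> Rd" "card T = 1 * m" "int m dvd (\<Sum>i\<in>T. a i)" by blast
    then show ?thesis using \<open>Rd \<subseteq> R\<close> by (intro disjI1) auto
  next
    case dense
    \<comment> \<open>Using the factor \<open>r\<close> instead of 1 on a block changes its exponent
      \<open>a i\<close> by \<open>(r - 1) * a i\<close>, so subset sums of these changes are
      needed. The remaining blocks of \<open>T\<close> keep the factor 1.\<close>
    have "\<exists>I'\<subseteq>R. card I' < m \<and> (\<forall>t. \<exists>F\<subseteq>I'. [t = (\<Sum>i\<in>F. (r - 1) * a i)] (mod int m))"
      using dense by (intro subset_sums_cover fin m_pos coprime_r_diff) (simp add: out_def)
    then obtain R' where R': "R' \<subseteq> R" "card R' < m"
      "\<And>t. \<exists>F\<subseteq>R'. [t = (\<Sum>i\<in>F. (r - 1) * a i)] (mod int m)" by blast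
    obtain T where T: "R' \<subseteq> T" "T \<subseteq> R" "card T = m - 1"
    proof -
      have "card R' \<le> m - 1" "m - 1 \<le> card R" using R'(2) card_R by auto
      then show ?thesis using exists_subset_between[of R' "m - 1" R] R'(1) fin that by blast
    qed
    obtain F where F: "F \<subseteq> R'" "[- w - (\<Sum>i\<in>T. a i) = (\<Sum>i\<in>F. (r - 1) * a i)] (mod int m)"
      using R'(3) by blast
    have finT: "finite T" using T fin finite_subset by blast
    let ?e = "\<lambda>i. if i \<in> F then 1 else (0::nat)"
    have "(\<Sum>i\<in>T. r ^ ?e i * a i) = (\<Sum>i\<in>T. a i + (if i \<in> F then (r - 1) * a i else 0))"
      by (rule sum.cong) (auto simp: algebra_simps)
    also have "\<dots> = (\<Sum>i\<in>T. a i) + (\<Sum>i\<in>F. (r - 1) * a i)"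
      using F(1) T(1) finT by (simp add: sum.distrib sum.If_cases inf.absorb2 subset_trans)
    finally have "w + (\<Sum>i\<in>T. r ^ ?e i * a i) = - (- w - (\<Sum>i\<in>T. a i) - (\<Sum>i\<in>F. (r - 1) * a i))"
      by simp
    then have "int m dvd w + (\<Sum>i\<in>T. r ^ ?e i * a i)"
      using F(2) by (simp only: cong_iff_dvd_diff dvd_minus_iff)
    then show ?thesis using T by (intro disjI2 exI[of _ T] conjI exI[of _ ?e])
  next
    case only
    show ?thesis
    proof (cases "card Z \<ge> m")
      case True
      then obtain T where T: "T \<subseteq> Z" "card T = m" using obtain_subset_with_card_n by metis
      then have "int m dvd (\<Sum>i\<in>T. a i)" by (intro dvd_sum) (auto simp: Z_def)
      then show ?thesis using T ZR by (intro disjI1 exI[of _ T]) auto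
    next
      case False
      \<comment> \<open>At least \<open>f\<close> blocks with nonvanishing exponent are needed to
        reach m - 1 blocks, which leaves exactly \<open>q\<close> others.\<close>
      define f where "f = m - 1 - card Z"
      have f: "card (out m) = q + f" "card Z + f = m - 1" using card_Z False by (auto simp: f_def)
      obtain F where F: "F \<subseteq> out m" "card F = f" "finite F"
        using obtain_subset_with_card_n[of f "out m"] f by auto
      define P where "P = out m - F"
      have P: "finite P" "card P = q" "F \<inter> P = {}" "F \<union> P = out m"
        using F f fin_out[of m] by (auto simp: P_def card_Diff_subset)
      \<comment> \<open>A block in \<open>F\<close> is always present, so only its change from
        \<open>a i\<close> varies. A block in \<open>P\<close> may be absent, shown by
        \<open>0\<close>, or present with any of the \<open>p\<close> multiples of
        \<open>a i\<close>.\<close>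
      define A where "A i = (if i \<in> F then {0, (r - 1) * a i} else insert 0 ((\<lambda>j. r ^ j * a i) ` {..<p}))" for i
      have nd: "\<not> int m dvd a i" if "i \<in> out m" for i using that by (simp add: out_def)
      have "gcd ((r - 1) * a i) (int m) = gcd (a i) (int m)" for i
        using coprime_r_diff by (metis coprime_commute gcd_mult_left_left_cancel)
      then have gF: "gcd (u - v) (int m) = gcd (a i) (int m)"
        if "u \<in> {0, (r - 1) * a i}" "v \<in> {0, (r - 1) * a i}" "u \<noteq> v" for i u v
        using that by (metis (no_types, lifting) diff_0_right diff_0 gcd_neg1_int insertE singletonD)
      have cF: "card (A i) - 1 = 1" if "i \<in> F" for i
      proof -
        have "(r - 1) * a i \<noteq> 0"
        proof
          assume "(r - 1) * a i = 0"
          then have "gcd (a i) (int m) = gcd 0 (int m)"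
            using \<open>gcd ((r - 1) * a i) (int m) = gcd (a i) (int m)\<close> by (simp only:)
          then have "int m dvd a i" by (metis abs_of_nat gcd_0_left_int gcd_dvd1)
          then show False using nd F(1) that by blast
        qed
        then show ?thesis using that by (auto simp: A_def)
      qed
      have cP: "card (A i) - 1 = p" if "i \<in> P" for i
        using orbit_card[of "{..<p}" "a i"] that nd[of i] P by (auto simp: A_def)
      have "\<exists>g. (\<forall>i\<in>out m. g i \<in> A i) \<and> [- w - (\<Sum>i\<in>F. a i) = (\<Sum>i\<in>out m. g i)] (mod int m)"
      proof (rule sums_cover[where a = a])
        show "gcd (u - v) (int m) = gcd (a i) (int m)" if "u \<in> A i" "v \<in> A i" "u \<noteq> v" for i u v
          using that gF[of u i v] orbit_gap[of "{..<p}" u "a i" v] by (auto simp: A_def split: if_splits)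
        fix d assume d: "d dvd m" "d > 1"
        have sub: "{i. i \<in> out m \<and> \<not> int d dvd a i} = out d"
          using d(1) by (auto simp: out_def)
        show "d \<le> (\<Sum>i | i \<in> out m \<and> \<not> int d dvd a i. card (A i) - 1) + 1"
        proof (cases "d = m")
          case True
          have "(\<Sum>i\<in>out m. card (A i) - 1) = (\<Sum>i\<in>F. card (A i) - 1) + (\<Sum>i\<in>P. card (A i) - 1)"
            unfolding P(4)[symmetric] using F P by (intro sum.union_disjoint) auto
          \<comment> \<open>The exchangeable blocks alone already gain q p = m - 1.\<close>
          moreover have "(\<Sum>i\<in>P. card (A i) - 1) = q * p" using P by (simp add: cP del: One_nat_def)
          ultimately show ?thesis using q sub True by simp
        next
          case False
          have "1 \<le> card (A i) - 1" if "i \<in> out d" for i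
          proof -
            have "i \<in> F \<union> P" using that sub P(4) by blast
            then show ?thesis using cF cP p_gt_1 by fastforce
          qed
          then have "card (out d) \<le> (\<Sum>i\<in>out d. card (A i) - 1)"
            using sum_mono[of "out d" "\<lambda>_. 1" "\<lambda>i. card (A i) - 1"] by simp
          then show ?thesis using only(1)[OF d False] sub by simp
        qed
      qed (use fin_out m_pos in \<open>auto simp: A_def\<close>)
      then obtain g where g: "\<forall>i\<in>out m. g i \<in> A i"
        "[- w - (\<Sum>i\<in>F. a i) = (\<Sum>i\<in>out m. g i)] (mod int m)" by blast
      define P' where "P' = {i \<in> P. g i \<noteq> 0}"
      have P': "P' \<subseteq> P" "card P' \<le> q" using P card_mono[of P P'] by (auto simp: P'_def)
      have "\<exists>e. r ^ e * a i = (if i \<in> F then a i + g i else if i \<in> P' then g i else a i)" for i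
      proof (cases "i \<in> F")
        case True
        then have "g i = 0 \<or> g i = (r - 1) * a i" using g(1) F(1) by (force simp: A_def)
        then have "r ^ 0 * a i = a i + g i \<or> r ^ 1 * a i = a i + g i" by (auto simp: algebra_simps)
        then have "\<exists>e. r ^ e * a i = a i + g i" by blast
        then show ?thesis using True by simp
      next
        case notF: False
        show ?thesis
        proof (cases "i \<in> P'")
          case True
          then have "g i \<in> A i" "g i \<noteq> 0" using g(1) P by (auto simp: P'_def)
          then obtain j where "g i = r ^ j * a i" using notF by (auto simp: A_def)
          then show ?thesis using notF True by auto
        qed (use notF in \<open>auto intro: exI[of _ 0]\<close>)
      qed
      then obtain e where e: "\<And>i. r ^ e i * a i = (if i \<in> F then a i + g i else if i \<in> P' then g i else a i)"
        by metis
      \<comment> \<open>From q + f <= m - 2 and \<open>card Z + f = m - 1\<close> follows q <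
        \<open>card Z\<close>. Each block of \<open>P'\<close> displaces one vanishing block, which
        keeps the total at m - 1.\<close>
      have "card P' \<le> card Z" using P'(2) f only(2) by simp
      then obtain Z' where Z': "Z' \<subseteq> Z" "card Z' = card Z - card P'" "finite Z'"
        using obtain_subset_with_card_n[of "card Z - card P'" Z] by auto
      have dis: "F \<inter> P' = {}" "(F \<union> P') \<inter> Z' = {}" "finite P'"
        using P' P F Z' ZR finite_subset by blast+
      define T where "T = F \<union> P' \<union> Z'"
      have TR: "T \<subseteq> R" using F P P' Z' ZR by (auto simp: T_def)
      have "card T = card F + card P' + card Z'"
        unfolding T_def using dis F Z' by (simp add: card_Un_disjoint)
      then have cT: "card T = m - 1" using F Z' f \<open>card P' \<le> card Z\<close> by simp
      have "(\<Sum>i\<in>T. r ^ e i * a i) = (\<Sum>i\<in>F. r ^ e i * a i) + (\<Sum>i\<in>P'. r ^ e i * a i) + (\<Sum>i\<in>Z'. r ^ e i * a i)"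
        unfolding T_def using dis F Z' by (simp add: sum.union_disjoint)
      moreover have "(\<Sum>i\<in>F. r ^ e i * a i) = (\<Sum>i\<in>F. a i) + (\<Sum>i\<in>F. g i)"
        by (simp add: e sum.distrib)
      moreover have "(\<Sum>i\<in>P'. r ^ e i * a i) = (\<Sum>i\<in>P. g i)"
        using dis P P' by (intro sum.mono_neutral_cong_left) (auto simp: P'_def e)
      moreover have "(\<Sum>i\<in>out m. g i) = (\<Sum>i\<in>F. g i) + (\<Sum>i\<in>P. g i)"
        unfolding P(4)[symmetric] using F P by (intro sum.union_disjoint) auto
      moreover have "int m dvd (\<Sum>i\<in>Z'. r ^ e i * a i)"
        using Z'(1) by (intro dvd_sum) (auto simp: Z_def)
      moreover have "int m dvd - w - (\<Sum>i\<in>F. a i) - (\<Sum>i\<in>out m. g i)"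
        using g(2) by (simp add: cong_iff_dvd_diff)
      ultimately have "int m dvd (\<Sum>i\<in>Z'. r ^ e i * a i) - (- w - (\<Sum>i\<in>F. a i) - (\<Sum>i\<in>out m. g i))"
        "w + (\<Sum>i\<in>T. r ^ e i * a i) = (\<Sum>i\<in>Z'. r ^ e i * a i) - (- w - (\<Sum>i\<in>F. a i) - (\<Sum>i\<in>out m. g i))"
        by (simp_all only: dvd_diff)
      then have "int m dvd w + (\<Sum>i\<in>T. r ^ e i * a i)" by (simp only:)
      then show ?thesis using TR cT by (intro disjI2 exI[of _ T] conjI exI[of _ e])
    qed
  qed
qed

end

section \<open>Attainable exponents of ordered index sets\<close>

locale weighted_sequence = fixed_point_free_action +
  fixes c :: "'i \<Rightarrow> nat" and b :: "'i \<Rightarrow> int"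
  assumes c_less: "c i < p"
begin

definition csum :: "'i list \<Rightarrow> nat" where
  "csum l = sum_list (map c l)"

text \<open>With \<open>i\<close> standing for the group element \<open>x\<^bsup>c i\<^esup> y\<^bsup>b i\<^esup>\<close>, the product over the list \<open>l\<close> is
  \<open>x\<^bsup>csum l\<^esup> y\<^bsup>wsum l\<^esup>\<close>.\<close>

primrec wsum :: "'i list \<Rightarrow> int" where
  "wsum [] = 0"
| "wsum (i # l) = b i * r ^ csum l + wsum l"

text \<open>Indices in place of group elements turn subsequences with multiplicity into sets; the
  value 0 means product one.\<close>

definition attains :: "'i set \<Rightarrow> int \<Rightarrow> bool" where
  "attains T t \<longleftrightarrow> (\<exists>l. distinct l \<and> set l = T \<and> p dvd csum l \<and> [wsum l = t] (mod int m))"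

text \<open>These are the available factors: a block with product y^v, inserted in front of a suffix
  of class \<open>j\<close>, is moved past x^j and then contributes the exponent r^j v.\<close>

definition suffix_sum :: "'i list \<Rightarrow> nat \<Rightarrow> bool" where
  "suffix_sum l j \<longleftrightarrow> (\<exists>u v. l = u @ v \<and> [csum v = j] (mod p))"

lemma csum_simps [simp]: "csum [] = 0" "csum (i # l) = c i + csum l" "csum (u @ v) = csum u + csum v"
  by (simp_all add: csum_def)

lemma csum_distinct: "distinct l \<Longrightarrow> csum l = sum c (set l)"
  by (simp add: csum_def sum_list_distinct_conv_sum_set)

lemma wsum_append: "wsum (u @ v) = wsum u * r ^ csum v + wsum v"
  by (induction u) (simp_all add: power_add algebra_simps)

lemma suffix_sum_0: "suffix_sum l 0"
  unfolding suffix_sum_def by (intro exI[of _ l] exI[of _ "[]"]) simp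

lemma r_pow_dvd:
  assumes "p dvd k"
  shows "[r ^ (k + j) = r ^ j] (mod int m)"
  using assms by (intro r_pow_cong) (auto simp: cong_def)

lemma attains_cong:
  assumes "attains T t" "[t = t'] (mod int m)"
  shows "attains T t'"
proof -
  obtain l where l: "distinct l" "set l = T" "p dvd csum l" "[wsum l = t] (mod int m)"
    using assms(1) by (auto simp: attains_def)
  then show ?thesis unfolding attains_def
    by (intro exI[of _ l]) (simp add: cong_trans[OF l(4) assms(2)])
qed

lemma attains_finite: "attains T t \<Longrightarrow> finite T"
  unfolding attains_def by auto

lemma attains_list:
  "distinct l \<Longrightarrow> p dvd csum l \<Longrightarrow> attains (set l) (wsum l)"
  unfolding attains_def by (intro exI[of _ l]) simp

lemma attains_exists:
  assumes "finite T" "p dvd sum c T"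
  shows "\<exists>t. attains T t"
proof -
  obtain l where "set l = T" "distinct l" using finite_distinct_list[OF assms(1)] by blast
  then show ?thesis using assms(2) csum_distinct attains_def by (metis cong_refl)
qed

lemma attains_singleton: "c i = 0 \<Longrightarrow> attains {i} (b i)"
  unfolding attains_def by (intro exI[of _ "[i]"]) simp

text \<open>Moving the prefix \<open>u\<close> to the end conjugates the product by that of
  \<open>u\<close>, and conjugation by x^k raises powers of \<open>y\<close> to the r^k.\<close>

lemma attains_rotate:
  assumes "distinct (u @ v)" "p dvd csum (u @ v)"
  shows "attains (set (u @ v)) (r ^ csum u * wsum (u @ v))"
proof -
  have "[wsum u * r ^ (csum u + csum v + 0) = wsum u * r ^ 0] (mod int m)"
    using assms(2) by (intro cong_mult cong_refl r_pow_dvd) simp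
  then have "[r ^ csum u * wsum (u @ v) = wsum u + r ^ csum u * wsum v] (mod int m)"
    by (simp add: wsum_append cong_iff_dvd_diff algebra_simps power_add)
  then have "[wsum (v @ u) = r ^ csum u * wsum (u @ v)] (mod int m)"
    by (simp add: wsum_append algebra_simps cong_sym)
  then show ?thesis
    unfolding attains_def using assms by (intro exI[of _ "v @ u"]) (auto simp: algebra_simps)
qed

text \<open>The inserted block has class 0, so the factors acting on the other terms do not change.
  That all suffix classes stay available is what permits further insertions.\<close>

lemma insert_zero_block:
  assumes "distinct l" "p dvd csum l" "suffix_sum l j" "attains M v" "M \<inter> set l = {}"
  shows "\<exists>l'. distinct l' \<and> set l' = set l \<union> M \<and> p dvd csum l'
    \<and> [wsum l' = wsum l + r ^ j * v] (mod int m) \<and> (\<forall>k. suffix_sum l k \<longrightarrow> suffix_sum l' k)"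
proof -
  obtain x y where l: "l = x @ y" "[csum y = j] (mod p)" using assms(3) by (auto simp: suffix_sum_def)
  obtain w where w: "distinct w" "set w = M" "p dvd csum w" "[wsum w = v] (mod int m)"
    using assms(4) by (auto simp: attains_def)
  let ?l = "x @ w @ y"
  have "[wsum ?l = wsum l + r ^ j * v] (mod int m)"
  proof -
    have "wsum ?l = wsum x * r ^ (csum w + csum y) + (wsum w * r ^ csum y + wsum y)"
      by (simp add: wsum_append)
    also have "[\<dots> = wsum x * r ^ csum y + (v * r ^ j + wsum y)] (mod int m)"
      using w l by (intro cong_add cong_mult cong_refl r_pow_dvd r_pow_cong) auto
    finally show ?thesis using l by (simp add: wsum_append algebra_simps)
  qed
  moreover have "suffix_sum ?l k" if k: "suffix_sum l k" for k
  proof -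
    obtain u' v' where uv: "l = u' @ v'" "[csum v' = k] (mod p)" using k by (auto simp: suffix_sum_def)
    then consider z where "x = u' @ z" "v' = z @ y" | z where "u' = x @ z" "y = z @ v'"
      using l by (auto simp: append_eq_append_conv2)
    then show ?thesis
    proof cases
      case 1
      then have "?l = u' @ (z @ w @ y)" by simp
      moreover have "[csum (z @ w @ y) = csum v'] (mod p)"
      proof -
        obtain q where "csum w = p * q" using w(3) by blast
        then have "csum (z @ w @ y) = csum v' + p * q" using 1 by simp
        then show ?thesis by (simp add: cong_def)
      qed
      ultimately show ?thesis unfolding suffix_sum_def using uv(2) cong_trans by blast
    next
      case 2
      then have "?l = (x @ w @ z) @ v'" by simp
      then show ?thesis unfolding suffix_sum_def using uv(2) by blast
    qed
  qed
  moreover have "p dvd csum ?l"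
    using assms(2) w(3) l(1) dvd_add[of p "csum x + csum y" "csum w"] by (simp add: algebra_simps)
  ultimately show ?thesis
    using assms l w by (intro exI[of _ ?l]) auto
qed

text \<open>Because insertion destroys no suffix class, the factors for the different blocks may be
  chosen independently. This turns the ordering problem into a sumset problem.\<close>

lemma attains_insert_blocks:
  assumes "finite K" "distinct l" "p dvd csum l"
    and "\<And>k. k \<in> K \<Longrightarrow> attains (M k) (v k)" "\<And>k. k \<in> K \<Longrightarrow> suffix_sum l (e k)"
    and "\<And>k. k \<in> K \<Longrightarrow> M k \<inter> set l = {}"
    and "\<And>k k'. k \<in> K \<Longrightarrow> k' \<in> K \<Longrightarrow> k \<noteq> k' \<Longrightarrow> M k \<inter> M k' = {}"
  shows "attains (set l \<union> (\<Union>k\<in>K. M k)) (wsum l + (\<Sum>k\<in>K. r ^ e k * v k))"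
proof -
  have "\<exists>l'. distinct l' \<and> set l' = set l \<union> (\<Union>k\<in>K. M k) \<and> p dvd csum l'
    \<and> [wsum l' = wsum l + (\<Sum>k\<in>K. r ^ e k * v k)] (mod int m) \<and> (\<forall>k. suffix_sum l k \<longrightarrow> suffix_sum l' k)"
    using assms(1,4-7)
  proof (induction K rule: finite_induct)
    case empty
    show ?case using assms(2,3) by (intro exI[of _ l]) simp
  next
    case (insert x F)
    obtain l' where l': "distinct l'" "set l' = set l \<union> (\<Union>k\<in>F. M k)" "p dvd csum l'"
      "[wsum l' = wsum l + (\<Sum>k\<in>F. r ^ e k * v k)] (mod int m)" "\<And>k. suffix_sum l k \<Longrightarrow> suffix_sum l' k"
    proof -
      have "\<exists>l'. distinct l' \<and> set l' = set l \<union> (\<Union>k\<in>F. M k) \<and> p dvd csum l'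
        \<and> [wsum l' = wsum l + (\<Sum>k\<in>F. r ^ e k * v k)] (mod int m) \<and> (\<forall>k. suffix_sum l k \<longrightarrow> suffix_sum l' k)"
        by (rule insert.IH) (use insert.prems in auto)
      then show ?thesis using that by blast
    qed
    have "M x \<inter> M k = {}" if "k \<in> F" for k
      using insert.prems(4)[of x k] that insert.hyps by auto
    then have "M x \<inter> set l' = {}" using l'(2) insert.prems(3)[of x] by auto
    then obtain l'' where l'': "distinct l''" "set l'' = set l' \<union> M x" "p dvd csum l''"
      "[wsum l'' = wsum l' + r ^ e x * v x] (mod int m)" "\<And>k. suffix_sum l' k \<Longrightarrow> suffix_sum l'' k"
      using insert_zero_block[OF l'(1,3), of "e x" "M x" "v x"] l'(5) insert.prems by blast
    have "[wsum l'' = wsum l + (\<Sum>k\<in>insert x F. r ^ e k * v k)] (mod int m)"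
      using cong_trans[OF l''(4) cong_add[OF l'(4) cong_refl]] insert.hyps by (simp add: algebra_simps)
    then show ?case using l' l'' by (intro exI[of _ l'']) auto
  qed
  then show ?thesis unfolding attains_def by blast
qed

lemma attains_Union:
  assumes "finite K" "\<And>k. k \<in> K \<Longrightarrow> attains (M k) (v k)"
    and "\<And>k k'. k \<in> K \<Longrightarrow> k' \<in> K \<Longrightarrow> k \<noteq> k' \<Longrightarrow> M k \<inter> M k' = {}"
  shows "attains (\<Union>k\<in>K. M k) (\<Sum>k\<in>K. v k)"
proof -
  have "attains (set [] \<union> (\<Union>k\<in>K. M k)) (wsum [] + (\<Sum>k\<in>K. r ^ 0 * v k))"
    using suffix_sum_0 by (intro attains_insert_blocks assms) auto
  then show ?thesis by simp
qed

lemma attains_Un: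
  assumes "attains S s" "attains T t" "S \<inter> T = {}"
  shows "attains (S \<union> T) (s + t)"
proof -
  obtain l where l: "distinct l" "set l = S" "p dvd csum l" "[wsum l = s] (mod int m)"
    using assms(1) by (auto simp: attains_def)
  have "attains (set l \<union> (\<Union>k\<in>{()}. T)) (wsum l + (\<Sum>k\<in>{()}. r ^ 0 * t))"
    using assms l suffix_sum_0 by (intro attains_insert_blocks) auto
  then show ?thesis using l attains_cong[of "S \<union> T" "wsum l + t" "s + t"]
    by (simp add: cong_add)
qed

section \<open>Short product-one sequences\<close>

text \<open>A minimal zero-sum sequence (atom) over Z/p. Minimality is what makes its partial sums
  distinct, see \<open>minimal_zero_inj\<close>.\<close>

definition minimal_zero :: "'i set \<Rightarrow> bool" where
  "minimal_zero B \<longleftrightarrow> finite B \<and> B \<noteq> {} \<and> p dvd sum c B \<and> (\<forall>E. E \<subset> B \<longrightarrow> E \<noteq> {} \<longrightarrow> \<not> p dvd sum c E)"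

lemma zero_subset:
  assumes "finite E" "card E \<ge> p"
  shows "\<exists>Y\<subseteq>E. Y \<noteq> {} \<and> p dvd sum c Y"
proof -
  obtain Y where "Y \<subseteq> E" "Y \<noteq> {}" "int p dvd (\<Sum>i\<in>Y. int (c i))"
    using nonempty_zero_sum_subset[OF assms(1) _ assms(2)] p_gt_1 by (metis less_imp_le_nat)
  then show ?thesis by (metis int_dvd_int_iff of_nat_sum)
qed

text \<open>The Davenport constant of Z/p is \<open>p\<close>: any \<open>p\<close> elements of a
  larger set contain a nonempty zero-sum subset, which would be proper.\<close>

lemma minimal_zero_card:
  assumes "minimal_zero B"
  shows "card B \<le> p"
proof (rule ccontr)
  assume "\<not> card B \<le> p"
  then obtain E where E: "E \<subseteq> B" "card E = p" "finite E"
    by (metis nat_le_linear obtain_subset_with_card_n)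
  then obtain Y where "Y \<subseteq> E" "Y \<noteq> {}" "p dvd sum c Y" using zero_subset by blast
  moreover have "E \<noteq> B" using E \<open>\<not> card B \<le> p\<close> by auto
  ultimately show False using assms E by (auto simp: minimal_zero_def)
qed

lemma minimal_zero_exists:
  assumes "finite E" "E \<noteq> {}" "p dvd sum c E"
  shows "\<exists>B\<subseteq>E. minimal_zero B"
  using assms
proof (induction E rule: finite_psubset_induct)
  case (psubset E)
  show ?case
  proof (cases "minimal_zero E")
    case False
    then obtain Y where "Y \<subset> E" "Y \<noteq> {}" "p dvd sum c Y"
      using psubset by (auto simp: minimal_zero_def)
    then show ?thesis using psubset.IH[of Y] by blast
  qed blast
qed

lemma minimal_zero_partition:
  assumes "finite E" "p dvd sum c E"
  shows "\<exists>R B. (\<forall>i\<in>R. i \<in> B i \<and> minimal_zero (B i))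
    \<and> (\<forall>i\<in>R. \<forall>j\<in>R. i \<noteq> j \<longrightarrow> B i \<inter> B j = {}) \<and> (\<Union>i\<in>R. B i) = E"
  using assms
proof (induction E rule: finite_psubset_induct)
  case (psubset E)
  show ?case
  proof (cases "E = {}")
    case True
    then show ?thesis by (intro exI[of _ "{}"]) simp
  next
    case False
    then obtain C where C: "C \<subseteq> E" "minimal_zero C"
      using minimal_zero_exists[OF psubset.hyps _ psubset.prems] by blast
    then obtain i where i: "i \<in> C" by (auto simp: minimal_zero_def)
    have "sum c E = sum c (E - C) + sum c C"
      using C(1) psubset.hyps by (simp add: sum.subset_diff)
    then have "p dvd sum c (E - C)"
      using psubset.prems C(2) by (simp add: minimal_zero_def dvd_add_left_iff)
    moreover have "E - C \<subset> E" using i C(1) by blast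
    ultimately have "\<exists>R B. (\<forall>i\<in>R. i \<in> B i \<and> minimal_zero (B i))
      \<and> (\<forall>i\<in>R. \<forall>j\<in>R. i \<noteq> j \<longrightarrow> B i \<inter> B j = {}) \<and> (\<Union>i\<in>R. B i) = E - C"
      using psubset.IH[of "E - C"] by blast
    then obtain R B where RB: "\<forall>i\<in>R. i \<in> B i \<and> minimal_zero (B i)"
      "\<forall>i\<in>R. \<forall>j\<in>R. i \<noteq> j \<longrightarrow> B i \<inter> B j = {}" "(\<Union>i\<in>R. B i) = E - C"
      by (elim exE conjE)
    have "i \<notin> R" "\<forall>j\<in>R. B j \<inter> C = {}" using RB i by blast+
    then show ?thesis
      using RB C i by (intro exI[of _ "insert i R"] exI[of _ "B(i := C)"]) auto
  qed
qed

text \<open>Zero-sum subsets are split off as long as at least \<open>p\<close> indices remain;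
  \<open>L\<close> is the remainder.\<close>

lemma zero_complement:
  assumes "finite E"
  shows "\<exists>L\<subseteq>E. p dvd sum c (E - L) \<and> card L < p"
  using assms
proof (induction E rule: finite_psubset_induct)
  case (psubset E)
  show ?case
  proof (cases "card E < p")
    case True
    then show ?thesis by (intro exI[of _ E]) simp
  next
    case False
    then obtain Y where Y: "Y \<subseteq> E" "Y \<noteq> {}" "p dvd sum c Y"
      using zero_subset psubset.hyps by (meson not_less)
    then obtain L where L: "L \<subseteq> E - Y" "p dvd sum c (E - Y - L)" "card L < p"
      using psubset.IH[of "E - Y"] by blast
    have "E - L = (E - Y - L) \<union> Y" "(E - Y - L) \<inter> Y = {}" using L Y by auto
    then have "sum c (E - L) = sum c (E - Y - L) + sum c Y"
      using psubset.hyps Y finite_subset by (metis finite_Diff sum.union_disjoint)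
    then show ?thesis using L Y by (intro exI[of _ L]) auto
  qed
qed

text \<open>Two equal partial sums would enclose a nonempty proper segment of class 0. Hence such a
  block offers as many powers of \<open>r\<close> as it has terms, through its prefixes when rotated
  and through its suffixes when others are inserted into it.\<close>

lemma minimal_zero_inj:
  assumes "minimal_zero (set l)" "distinct l"
  shows "inj_on (\<lambda>i. csum (take i l) mod p) {..<length l}"
    and "inj_on (\<lambda>i. csum (drop i l) mod p) {..<length l}"
proof -
  have mid: "\<not> p dvd csum (take (j - i) (drop i l))" if "i < j" "j < length l" for i j
  proof -
    let ?w = "take (j - i) (drop i l)"
    have "distinct ?w" "length ?w = j - i" using that assms(2) by auto
    then have "card (set ?w) = j - i" using distinct_card by metis
    moreover have "set ?w \<subseteq> set l" by (meson set_drop_subset set_take_subset subset_trans)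
    moreover have "card (set l) = length l" using assms(2) by (rule distinct_card)
    ultimately have "set ?w \<subset> set l" "set ?w \<noteq> {}" using that by auto
    then show ?thesis
      using assms(1) csum_distinct[OF \<open>distinct ?w\<close>] by (auto simp: minimal_zero_def)
  qed
  have split: "take j l = take i l @ take (j - i) (drop i l)" "drop i l = take (j - i) (drop i l) @ drop j l"
    if "i < j" for i j
    using that by (metis le_add_diff_inverse less_imp_le_nat take_add)
      (metis append_take_drop_id drop_drop le_add_diff_inverse2 less_imp_le_nat that)
  have ne1: "csum (take i l) mod p \<noteq> csum (take j l) mod p" if "i < j" "j < length l" for i j
  proof
    assume eq: "csum (take i l) mod p = csum (take j l) mod p"
    have "csum (take j l) = csum (take i l) + csum (take (j - i) (drop i l))"
      by (subst split(1)[OF that(1)]) simp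
    then have "[csum (take i l) + csum (take (j - i) (drop i l)) = csum (take i l)] (mod p)"
      using eq by (simp add: cong_def)
    then show False using mid[OF that] by (simp add: cong_add_lcancel_0_nat cong_0_iff)
  qed
  have ne2: "csum (drop i l) mod p \<noteq> csum (drop j l) mod p" if "i < j" "j < length l" for i j
  proof
    assume eq: "csum (drop i l) mod p = csum (drop j l) mod p"
    have "csum (drop i l) = csum (take (j - i) (drop i l)) + csum (drop j l)"
      by (subst split(2)[OF that(1)]) simp
    then have "[csum (take (j - i) (drop i l)) + csum (drop j l) = csum (drop j l)] (mod p)"
      using eq by (simp add: cong_def)
    then show False using mid[OF that] by (simp add: cong_add_rcancel_0_nat cong_0_iff)
  qed
  show "inj_on (\<lambda>i. csum (take i l) mod p) {..<length l}"
    by (rule inj_onI) (metis ne1 lessThan_iff linorder_neqE_nat)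
  show "inj_on (\<lambda>i. csum (drop i l) mod p) {..<length l}"
    by (rule inj_onI) (metis ne2 lessThan_iff linorder_neqE_nat)
qed

text \<open>A single term of class \<open>0\<close> can be inserted into \<open>W\<close> at \<open>card W\<close> essentially different
  places, and rotating the block \<open>B i\<close> multiplies its exponent by \<open>card (B i)\<close> different powers of \<open>r\<close>;
  all of them may also be left out. This explains the right-hand side of the gain inequality.\<close>

lemma product_one_from_partition:
  assumes "odd p" "m > 1" "finite I" "card I + 1 \<ge> m + p"
    and L: "L \<subseteq> {i \<in> I. c i \<noteq> 0}" "card L < p"
    and W: "W \<subseteq> {i \<in> I. c i \<noteq> 0} - L" "minimal_zero W"
    and RB: "\<forall>i\<in>R. i \<in> B i \<and> minimal_zero (B i)" "\<forall>i\<in>R. \<forall>j\<in>R. i \<noteq> j \<longrightarrow> B i \<inter> B j = {}"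
      "(\<Union>i\<in>R. B i) = {i \<in> I. c i \<noteq> 0} - L - W"
    and gain: "m \<le> card W * card {i \<in> I. c i = 0} + (\<Sum>i\<in>R. card (B i)) + 1"
  shows "\<exists>T\<subseteq>I. T \<noteq> {} \<and> attains T 0"
proof (rule ccontr)
  assume none: "\<not> ?thesis"
  define N where "N = {i \<in> I. c i = 0}"
  define K where "K = N \<union> R"
  have finN: "finite N" using assms(3) by (simp add: N_def)
  have R: "i \<in> I" "c i \<noteq> 0" if "i \<in> R" for i using that RB(1,3) by auto
  have finR: "finite R" using R assms(3) by (meson finite_subset subsetI)
  have disjNR: "N \<inter> R = {}" using R(2) by (fastforce simp: N_def)
  have finK: "finite K" using finN finR by (simp add: K_def)
  have finB: "finite (B i)" if "i \<in> R" for i using RB(1) that by (simp add: minimal_zero_def)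
  obtain l0 where l0: "set l0 = W" "distinct l0"
    using W(2) finite_distinct_list by (auto simp: minimal_zero_def)
  have zero0: "p dvd csum l0" using l0 W(2) csum_distinct by (simp add: minimal_zero_def)
  define lst where "lst k = (if c k = 0 then [k] else (SOME l. set l = B k \<and> distinct l))" for k
  define M where "M k = set (lst k)" for k
  define a where "a k = wsum (lst k)" for k
  \<comment> \<open>Available powers of \<open>r\<close>: a term of class 0 can be inserted before
    any nonempty suffix of \<open>l0\<close>, a block can be rotated at any of its positions. The
    \<open>0\<close> in \<open>A\<close> below stands for leaving the item out.\<close>
  define J where "J k = (if c k = 0 then (\<lambda>i. csum (drop i l0) mod p) ` {..<length l0}
     else (\<lambda>i. csum (take i (lst k)) mod p) ` {..<length (lst k)})" for k
  define A where "A k = insert 0 ((\<lambda>j. r ^ j * a k) ` J k)" for k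
  have lstN: "lst k = [k]" "M k = {k}" "c k = 0" if "k \<in> N" for k
    using that by (auto simp: lst_def M_def N_def)
  have lstR: "set (lst k) = B k \<and> distinct (lst k)" if "k \<in> R" for k
  proof -
    have "\<exists>l. set l = B k \<and> distinct l" using finite_distinct_list[OF finB[OF that]] by blast
    then have "set (SOME l. set l = B k \<and> distinct l) = B k \<and> distinct (SOME l. set l = B k \<and> distinct l)"
      by (rule someI_ex)
    then show ?thesis using R(2)[OF that] by (simp add: lst_def)
  qed
  have MR: "M k = B k" if "k \<in> R" for k using lstR[OF that] by (simp add: M_def)
  have zeroM: "distinct (lst k) \<and> p dvd csum (lst k)" if "k \<in> K" for k
  proof (cases "k \<in> N")
    case False
    then have "k \<in> R" using that by (simp add: K_def)
    then show ?thesis using lstR RB(1) csum_distinct by (metis minimal_zero_def)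
  qed (simp add: lstN)
  then have att: "attains (M k) (a k)" if "k \<in> K" for k
    using that attains_list by (simp add: M_def a_def)
  have MI: "M k \<subseteq> I" "M k \<noteq> {}" "M k \<inter> W = {}" if "k \<in> K" for k
  proof -
    have "M k \<subseteq> I \<and> M k \<noteq> {} \<and> M k \<inter> W = {}"
    proof (cases "k \<in> N")
      case True
      then show ?thesis using lstN[OF True] W(1) by (auto simp: N_def)
    next
      case False
      then have "k \<in> R" using that by (simp add: K_def)
      then show ?thesis using MR RB(1,3) by fastforce
    qed
    then show "M k \<subseteq> I" "M k \<noteq> {}" "M k \<inter> W = {}" by auto
  qed
  have Mdisj: "M k \<inter> M k' = {}" if kk: "k \<in> K" "k' \<in> K" "k \<noteq> k'" for k k'
  proof -
    have *: "M k \<inter> M k' = {}" if "k \<in> N" "k' \<in> R" for k k'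
    proof -
      have "B k' \<subseteq> {i. c i \<noteq> 0}" using RB(3) that(2) by blast
      then show ?thesis using lstN[OF that(1)] MR[OF that(2)] by auto
    qed
    show ?thesis
    proof (cases "k \<in> N")
      case True
      then show ?thesis
        using kk lstN[of k] lstN[of k'] *[of k k'] by (cases "k' \<in> N") (auto simp: K_def)
    next
      case False
      then show ?thesis
        using kk *[of k' k] MR RB(2) by (cases "k' \<in> N") (auto simp: K_def)
    qed
  qed
  \<comment> \<open>An item with vanishing exponent would be a product-one subset by itself.\<close>
  have not_dvd: "\<not> int m dvd a k" if "k \<in> K" for k
  proof
    assume "int m dvd a k"
    then have "attains (M k) 0" using attains_cong[OF att[OF that]] by (simp add: cong_0_iff)
    then show False using none MI[OF that] by blast
  qed
  have J_sub: "J k \<subseteq> {..<p}" for k using p_gt_1 by (auto simp: J_def)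
  have J_card: "card (J k) = (if k \<in> N then card W else card (B k))" if "k \<in> K" for k
  proof (cases "k \<in> N")
    case True
    have "card (J k) = length l0"
      using minimal_zero_inj(2)[of l0] l0 W(2) lstN(3)[OF True] by (simp add: J_def card_image)
    then show ?thesis using True l0 distinct_card by fastforce
  next
    case False
    then have k: "k \<in> R" using that by (simp add: K_def)
    have "card (J k) = length (lst k)"
      using minimal_zero_inj(1)[of "lst k"] lstR[OF k] RB(1) k R(2)[OF k] by (simp add: J_def card_image)
    then show ?thesis using False lstR[OF k] distinct_card by fastforce
  qed
  have W_pos: "card W \<ge> 1" using W(2) by (simp add: minimal_zero_def Suc_leI card_gt_0_iff)
  have item: "\<exists>e v. suffix_sum l0 e \<and> attains (M k) v \<and> r ^ e * v = u" if k: "k \<in> K" and u: "u \<in> A k" "u \<noteq> 0" for k u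
  proof -
    obtain j where j: "j \<in> J k" "u = r ^ j * a k" using u by (auto simp: A_def)
    show ?thesis
    proof (cases "k \<in> N")
      case True
      then obtain i where "j = csum (drop i l0) mod p" using j lstN(3) by (auto simp: J_def)
      then have "suffix_sum l0 j"
        unfolding suffix_sum_def
        by (intro exI[of _ "take i l0"] exI[of _ "drop i l0"]) (simp add: cong_def)
      then show ?thesis using j att[OF k] by blast
    next
      case False
      then have kR: "k \<in> R" using k by (simp add: K_def)
      then obtain i where i: "j = csum (take i (lst k)) mod p" using j R(2) by (auto simp: J_def)
      have "attains (set (take i (lst k) @ drop i (lst k)))
        (r ^ csum (take i (lst k)) * wsum (take i (lst k) @ drop i (lst k)))"
        using zeroM[OF k] by (intro attains_rotate) simp_all
      then have "attains (M k) (r ^ csum (take i (lst k)) * a k)" by (simp add: M_def a_def)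
      moreover have "[r ^ csum (take i (lst k)) * a k = u] (mod int m)"
        unfolding j(2) i by (intro cong_mult cong_refl r_pow_cong) (simp add: cong_def)
      ultimately have "attains (M k) u" by (rule attains_cong)
      then show ?thesis using suffix_sum_0[of l0] by (intro exI[of _ 0] exI[of _ u]) simp
    qed
  qed
  have card_le: "card (M k) \<le> card (J k)" if "k \<in> K" for k
    using J_card[OF that] W_pos lstN(2)[of k] MR[of k] that by (auto simp: K_def)
  have "\<exists>f. (\<forall>k\<in>K. f k \<in> A k) \<and> [- wsum l0 = (\<Sum>k\<in>K. f k)] (mod int m)"
  proof (rule sums_cover[where a = a])
    show "finite (A k)" for k
      unfolding A_def using J_sub[of k] finite_subset by blast
    show "gcd (u - v) (int m) = gcd (a k) (int m)" if "u \<in> A k" "v \<in> A k" "u \<noteq> v" for k u v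
      using orbit_gap[OF J_sub] that unfolding A_def by blast
    fix d assume d: "d dvd m" "d > 1"
    have cardA: "card (A k) - 1 = card (J k)" if "k \<in> K" for k
      unfolding A_def by (rule orbit_card[OF J_sub not_dvd[OF that]])
    define Kd where "Kd = {k \<in> K. int d dvd a k}"
    have KKd: "{k. k \<in> K \<and> \<not> int d dvd a k} = K - Kd" by (auto simp: Kd_def)
    have finKd: "finite Kd" using finK by (simp add: Kd_def)
    have sum_eq: "(\<Sum>k | k \<in> K \<and> \<not> int d dvd a k. card (A k) - 1) = (\<Sum>k\<in>K - Kd. card (J k))"
      unfolding KKd by (rule sum.cong) (simp_all add: cardA del: One_nat_def)
    show "d \<le> (\<Sum>k | k \<in> K \<and> \<not> int d dvd a k. card (A k) - 1) + 1"
    proof (cases "d = m")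
      case True
      then have "Kd = {}" using not_dvd by (auto simp: Kd_def)
      moreover have "(\<Sum>k\<in>K. card (J k)) = (\<Sum>k\<in>N. card (J k)) + (\<Sum>k\<in>R. card (J k))"
        unfolding K_def using finN finR disjNR by (rule sum.union_disjoint)
      moreover have "(\<Sum>k\<in>N. card (J k)) = (\<Sum>k\<in>N. card W)"
        by (rule sum.cong) (auto simp: J_card K_def)
      moreover have "(\<Sum>k\<in>R. card (J k)) = (\<Sum>k\<in>R. card (B k))"
        using disjNR by (intro sum.cong) (auto simp: J_card K_def)
      ultimately show ?thesis using gain sum_eq True by (simp add: N_def mult.commute)
    next
      case False
      obtain e where e: "m = d * e" using d(1) by blast
      have "e \<noteq> 0" using e assms(2) by (metis mult_0_right not_less_zero)
      moreover have "e \<noteq> 1" using e False by auto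
      ultimately have e2: "e \<ge> 2" by simp
      have dbig: "d \<ge> 2 * p + 1" using divisor_large(2)[OF d assms(1)] .
      show ?thesis
      proof (rule ccontr)
        assume "\<not> ?thesis"
        then have small: "(\<Sum>k\<in>K - Kd. card (J k)) + 2 \<le> d" using sum_eq by simp
        \<comment> \<open>Among \<open>e\<close> exponents divisible by \<open>d\<close>, some
          nonempty subset has a sum divisible by d e = m, and the union of its items would be a
          product-one subset.\<close>
        have "card Kd < e"
        proof (rule ccontr)
          assume "\<not> card Kd < e"
          then obtain F where F: "F \<subseteq> Kd" "F \<noteq> {}" "int e dvd (\<Sum>k\<in>F. a k div int d)"
            using nonempty_zero_sum_subset[OF finKd, of e "\<lambda>k. a k div int d"] e2 by auto
          have "(\<Sum>k\<in>F. a k) = (\<Sum>k\<in>F. int d * (a k div int d))"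
            using F(1) by (intro sum.cong) (auto simp: Kd_def)
          then have dvd: "int m dvd (\<Sum>k\<in>F. a k)"
            using F(3) e by (simp add: sum_distrib_left[symmetric])
          have FK: "F \<subseteq> K" using F(1) by (auto simp: Kd_def)
          have "attains (\<Union>k\<in>F. M k) (\<Sum>k\<in>F. a k)"
            using FK finite_subset[OF FK finK] att Mdisj by (intro attains_Union) blast+
          then have "attains (\<Union>k\<in>F. M k) 0"
            using attains_cong dvd by (metis cong_0_iff)
          moreover have "(\<Union>k\<in>F. M k) \<subseteq> I" using MI(1) FK by blast
          moreover have "(\<Union>k\<in>F. M k) \<noteq> {}" using MI(2) FK F(2) by blast
          ultimately show False using none by blast
        qed
        \<comment> \<open>Now the terms are counted: items outside \<open>Kd\<close> occupy at most
          d - 2 of them, the fewer than \<open>e\<close> items in \<open>Kd\<close> at most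
          \<open>p\<close> each, and \<open>L\<close> and \<open>W\<close> the rest. This is too few
          for \<open>card I\<close>.\<close>
        have MJ1: "(\<Sum>k\<in>K - Kd. card (M k)) \<le> (\<Sum>k\<in>K - Kd. card (J k))"
          by (intro sum_mono card_le) simp
        have "card (M k) \<le> p" if "k \<in> K" for k
          using that lstN(2)[of k] MR[of k] RB(1) minimal_zero_card p_gt_1 by (auto simp: K_def)
        then have MJ2: "(\<Sum>k\<in>Kd. card (M k)) \<le> card Kd * p"
          using sum_bounded_above[of Kd "\<lambda>k. card (M k)" p] by (auto simp: Kd_def)
        have "(\<Sum>k\<in>K. card (M k)) = (\<Sum>k\<in>K - Kd. card (M k)) + (\<Sum>k\<in>Kd. card (M k))"
          using finK by (intro sum.subset_diff) (auto simp: Kd_def)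
        moreover have "(\<Sum>k\<in>K. card (M k)) = card (\<Union>k\<in>K. M k)"
          using finK Mdisj by (intro card_UN_disjoint[symmetric]) (auto simp: M_def)
        moreover have "I \<subseteq> (\<Union>k\<in>K. M k) \<union> (L \<union> W)"
        proof
          fix i assume "i \<in> I"
          show "i \<in> (\<Union>k\<in>K. M k) \<union> (L \<union> W)"
          proof (cases "c i = 0")
            case True
            then have "i \<in> N" using \<open>i \<in> I\<close> by (simp add: N_def)
            then show ?thesis using lstN(2)[of i] by (auto simp: K_def)
          next
            case False
            show ?thesis
            proof (cases "i \<in> L \<union> W")
              case False
              then have "i \<in> (\<Union>i\<in>R. B i)" using RB(3) \<open>c i \<noteq> 0\<close> \<open>i \<in> I\<close> by blast
              then show ?thesis using MR by (auto simp: K_def)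
            qed blast
          qed
        qed
        then have "card I \<le> card (\<Union>k\<in>K. M k) + card (L \<union> W)"
          using finK finite_subset[OF L(1)] assms(3) W(2)
          by (intro order.trans[OF card_mono card_Un_le]) (auto simp: M_def minimal_zero_def)
        moreover have "card (L \<union> W) \<le> card L + card W" by (rule card_Un_le)
        moreover have "card W \<le> p" using minimal_zero_card[OF W(2)] .
        ultimately have "m + p \<le> (d - 2) + card Kd * p + card L + p + 1"
          using MJ1 MJ2 small assms(4) by linarith
        moreover have "card Kd * p + p \<le> e * p"
          using \<open>card Kd < e\<close> mult_le_mono1[of "Suc (card Kd)" e p] by simp
        ultimately have "d * e + 2 \<le> d + e * p" using L(2) e small by linarith
        \<comment> \<open>Equivalent to (d - p)(e - 1) >= p + 1, true for d >= 2p + 1 and e >=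
          2.\<close>
        moreover have "d * e \<ge> e * p + d + 1"
        proof -
          obtain x where x: "d = 2 * p + 1 + x" using dbig le_Suc_ex by blast
          obtain y where y: "e = 2 + y" using e2 le_Suc_ex by blast
          show ?thesis unfolding x y by (simp add: algebra_simps)
        qed
        ultimately show False by linarith
      qed
    qed
  qed (use finK m_pos in \<open>auto simp: A_def\<close>)
  then obtain f where f: "\<forall>k\<in>K. f k \<in> A k" "[- wsum l0 = (\<Sum>k\<in>K. f k)] (mod int m)" by blast
  define K' where "K' = {k \<in> K. f k \<noteq> 0}"
  have "\<forall>k\<in>K'. \<exists>e v. suffix_sum l0 e \<and> attains (M k) v \<and> r ^ e * v = f k"
    using item f(1) by (auto simp: K'_def)
  then obtain e v where ev: "\<forall>k\<in>K'. suffix_sum l0 (e k) \<and> attains (M k) (v k) \<and> r ^ e k * v k = f k"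
    by metis
  have "attains (set l0 \<union> (\<Union>k\<in>K'. M k)) (wsum l0 + (\<Sum>k\<in>K'. r ^ e k * v k))"
    using finK l0 zero0 ev MI Mdisj by (intro attains_insert_blocks) (auto simp: K'_def)
  moreover have "(\<Sum>k\<in>K'. r ^ e k * v k) = (\<Sum>k\<in>K. f k)"
    using finK ev by (intro sum.mono_neutral_cong_left) (auto simp: K'_def)
  moreover have "[wsum l0 + (\<Sum>k\<in>K. f k) = 0] (mod int m)"
    using f(2) by (simp add: cong_iff_dvd_diff) (metis add.commute dvd_minus_iff minus_add_distrib uminus_add_conv_diff minus_diff_eq diff_minus_eq_add)
  ultimately have "attains (W \<union> (\<Union>k\<in>K'. M k)) 0" using attains_cong l0(1) by metis
  moreover have "W \<union> (\<Union>k\<in>K'. M k) \<subseteq> I" using MI(1) W(1) by (auto simp: K'_def)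
  moreover have "W \<noteq> {}" using W(2) by (simp add: minimal_zero_def)
  ultimately show False using none by blast
qed

text \<open>No class contains \<open>p\<close> of the indices, so any \<open>p\<close> of them
  include two of different classes.\<close>

lemma pair_blocks:
  assumes "finite E" "\<And>i. i \<in> E \<Longrightarrow> card {j \<in> E. c j = c i} < p" "card E + 2 \<ge> k * 2 + p"
  shows "\<exists>R B. R \<subseteq> E \<and> card R = k \<and> (\<forall>i\<in>R. i \<in> B i \<and> B i \<subseteq> E \<and> card (B i) = 2 \<and> inj_on c (B i))
    \<and> (\<forall>i\<in>R. \<forall>j\<in>R. i \<noteq> j \<longrightarrow> B i \<inter> B j = {})"
proof (rule disjoint_blocks[OF assms(1) _ _ assms(3)])
  fix Y assume Y: "Y \<subseteq> E" "p \<le> card Y"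
  then obtain i where i: "i \<in> Y" using p_gt_1 by fastforce
  have "\<not> Y \<subseteq> {j \<in> E. c j = c i}"
    using assms(2)[of i] i Y card_mono[of "{j \<in> E. c j = c i}" Y] assms(1) by fastforce
  then obtain j where j: "j \<in> Y" "c j \<noteq> c i" using Y by blast
  then show "\<exists>B\<subseteq>Y. card B = 2 \<and> inj_on c B"
    using i by (intro exI[of _ "{i, j}"]) (auto simp: card_2_iff inj_on_def)
qed simp

text \<open>Cauchy--Davenport modulo \<open>p\<close> for the sets formed by 0 and the two classes
  of a pair. Each gains 2, so (p - 1)/2 pairs represent every residue; the value 0 means that
  nothing is taken from the pair.\<close>

lemma pair_sums:
  assumes "finite R" "\<And>i. i \<in> R \<Longrightarrow> card (B i) = 2 \<and> inj_on c (B i) \<and> 0 \<notin> c ` B i"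
    and "\<And>i j. i \<in> R \<Longrightarrow> j \<in> R \<Longrightarrow> i \<noteq> j \<Longrightarrow> B i \<inter> B j = {}" "p \<le> 2 * card R + 1"
  shows "\<exists>L\<subseteq>(\<Union>i\<in>R. B i). card L \<le> card R \<and> [t = int (sum c L)] (mod int p)"
proof -
  define A where "A i = insert 0 ((\<lambda>x. int (c x)) ` B i)" for i
  have finB: "finite (B i)" if "i \<in> R" for i using assms(2)[OF that] card.infinite by fastforce
  have "\<exists>f. (\<forall>i\<in>R. f i \<in> A i) \<and> [t = (\<Sum>i\<in>R. f i)] (mod int p)"
  proof (rule sums_cover[where a = "\<lambda>_. 1"])
    fix i u v assume uv: "i \<in> R" "u \<in> A i" "v \<in> A i" "u \<noteq> v"
    have "0 \<le> w \<and> w < int p" if "w \<in> A i" for w using that c_less p_gt_1 by (auto simp: A_def)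
    then have "\<not> int p dvd u - v"
      using uv by (smt (verit) zdvd_not_zless dvd_minus_iff)
    then have "coprime (int p) (u - v)" using prime_p by (intro prime_imp_coprime) auto
    then show "gcd (u - v) (int p) = gcd 1 (int p)" by (simp add: coprime_iff_gcd_eq_1 gcd.commute)
  next
    fix d assume d: "d dvd p" "d > 1"
    have "card (A i) - 1 = 2" if "i \<in> R" for i
    proof -
      have "card ((\<lambda>x. int (c x)) ` B i) = 2"
        using assms(2)[OF that] by (subst card_image) (auto simp: inj_on_def)
      moreover have "0 \<notin> (\<lambda>x. int (c x)) ` B i" using assms(2)[OF that] by auto
      ultimately show ?thesis using finB[OF that] by (simp add: A_def)
    qed
    then have "(\<Sum>i | i \<in> R \<and> \<not> int d dvd 1. card (A i) - 1) = 2 * card R"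
      using d(2) by (simp del: One_nat_def)
    moreover have "d = p" using d prime_p prime_nat_iff by auto
    ultimately show "d \<le> (\<Sum>i | i \<in> R \<and> \<not> int d dvd 1. card (A i) - 1) + 1" using assms(4) by simp
  qed (use assms(1) p_gt_1 finB in \<open>auto simp: A_def\<close>)
  then obtain f where f: "\<forall>i\<in>R. f i \<in> A i" "[t = (\<Sum>i\<in>R. f i)] (mod int p)" by blast
  define R' where "R' = {i \<in> R. f i \<noteq> 0}"
  have "\<forall>i\<in>R'. \<exists>x. x \<in> B i \<and> int (c x) = f i" using f(1) by (fastforce simp: R'_def A_def)
  then obtain h where h: "\<forall>i\<in>R'. h i \<in> B i \<and> int (c (h i)) = f i" by metis
  have inj: "inj_on h R'"
  proof (rule inj_onI, rule ccontr)
    fix i j assume ij: "i \<in> R'" "j \<in> R'" "h i = h j" "i \<noteq> j"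
    then have "h i \<in> B i \<inter> B j" using h by (metis IntI)
    then show False using assms(3)[of i j] ij by (auto simp: R'_def)
  qed
  have "int (sum c (h ` R')) = (\<Sum>i\<in>R'. f i)"
    using inj h by (simp add: sum.reindex)
  also have "\<dots> = (\<Sum>i\<in>R. f i)"
    using assms(1) by (intro sum.mono_neutral_left) (auto simp: R'_def)
  finally have "[t = int (sum c (h ` R'))] (mod int p)" using f(2) by simp
  moreover have "card (h ` R') \<le> card R"
    using assms(1) card_image_le[of R' h] card_mono[of R R'] by (fastforce simp: R'_def)
  moreover have "h ` R' \<subseteq> (\<Union>i\<in>R. B i)" using h by (auto simp: R'_def)
  ultimately show ?thesis by blast
qed

text \<open>If every term has nonzero class, the gain inequality needs \<open>card L + card W \<le> p\<close>; such short
  \<open>L\<close> and \<open>W\<close> are found inside disjoint pairs of terms of different classes.\<close>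

lemma exists_product_one_subset:
  assumes "odd p" "m > 1" "finite I" "card I + 1 \<ge> m + p"
    and cls: "\<And>i. i \<in> I \<Longrightarrow> c i \<noteq> 0 \<Longrightarrow> card {j \<in> I. c j = c i} < p"
  shows "\<exists>T\<subseteq>I. T \<noteq> {} \<and> attains T 0"
proof -
  define N where "N = {i \<in> I. c i = 0}"
  define Q where "Q = {i \<in> I. c i \<noteq> 0}"
  have fin: "finite N" "finite Q" using assms(3) by (simp_all add: N_def Q_def)
  have "I = N \<union> Q" "N \<inter> Q = {}" by (auto simp: N_def Q_def)
  then have cardI: "card I = card N + card Q" using fin by (simp add: card_Un_disjoint)
  \<comment> \<open>Any admissible \<open>L\<close> and \<open>W\<close> suffice: the rest of
    \<open>Q\<close> splits into minimal zero-sum blocks, whose sizes add up to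
    \<open>card Q - card L - card W\<close>.\<close>
  have finish: ?thesis
    if L: "L \<subseteq> Q" "card L < p" "p dvd sum c (Q - L)" and W: "W \<subseteq> Q - L" "minimal_zero W"
      and gain: "m \<le> card W * card N + (card Q - card L - card W) + 1" for L W
  proof -
    have finL: "finite L" using L(1) fin(2) finite_subset by blast
    have finW: "finite W" using W(2) by (simp add: minimal_zero_def)
    have "sum c (Q - L) = sum c (Q - L - W) + sum c W"
      using fin W(1) by (intro sum.subset_diff) auto
    then have "p dvd sum c (Q - L - W)"
      using L(3) W(2) by (simp add: minimal_zero_def dvd_add_left_iff)
    then have "\<exists>R B. (\<forall>i\<in>R. i \<in> B i \<and> minimal_zero (B i))
      \<and> (\<forall>i\<in>R. \<forall>j\<in>R. i \<noteq> j \<longrightarrow> B i \<inter> B j = {}) \<and> (\<Union>i\<in>R. B i) = Q - L - W"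
      using fin by (intro minimal_zero_partition) auto
    then obtain R B where RB: "\<forall>i\<in>R. i \<in> B i \<and> minimal_zero (B i)"
      "\<forall>i\<in>R. \<forall>j\<in>R. i \<noteq> j \<longrightarrow> B i \<inter> B j = {}" "(\<Union>i\<in>R. B i) = Q - L - W" by (elim exE conjE)
    have "finite R" using RB(1,3) fin(2) by (intro finite_subset[of R Q]) auto
    then have "(\<Sum>i\<in>R. card (B i)) = card (\<Union>i\<in>R. B i)"
      using RB(1,2) by (intro card_UN_disjoint[symmetric]) (auto simp: minimal_zero_def)
    also have "\<dots> = card Q - card L - card W"
      unfolding RB(3) using finL finW L(1) W(1) by (simp add: card_Diff_subset)
    finally have "m \<le> card W * card N + (\<Sum>i\<in>R. card (B i)) + 1" using gain by simp
    then show ?thesis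
      using product_one_from_partition[OF assms(1-4), of L W R B] L W RB
      unfolding Q_def N_def by blast
  qed
  show ?thesis
  proof (cases "card Q < p")
    case True
    then have "card N \<ge> m" using assms(4) cardI by simp
    then obtain T where T: "T \<subseteq> N" "T \<noteq> {}" "int m dvd (\<Sum>i\<in>T. b i)"
      using nonempty_zero_sum_subset[OF fin(1) m_pos] by blast
    have "attains (\<Union>i\<in>T. {i}) (\<Sum>i\<in>T. b i)"
      using T(1) fin finite_subset by (intro attains_Union attains_singleton) (auto simp: N_def)
    then have "attains T 0" using T(3) attains_cong[of T "\<Sum>i\<in>T. b i" 0] by (simp add: cong_0_iff)
    then show ?thesis using T by (auto simp: N_def)
  next
    case big: False
    show ?thesis
    proof (cases "N = {}")
      case False
      obtain L where L: "L \<subseteq> Q" "p dvd sum c (Q - L)" "card L < p"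
        using zero_complement[OF fin(2)] by blast
      have "Q - L \<noteq> {}" using L big fin by (metis card_mono finite_subset le_less_trans Diff_eq_empty_iff)
      then obtain W where W: "W \<subseteq> Q - L" "minimal_zero W"
        using minimal_zero_exists[of "Q - L"] L(2) fin by auto
      have "card W \<le> card (Q - L)" using W(1) fin by (intro card_mono) auto
      then have le: "card W + card L \<le> card Q"
        using L(1) fin card_mono[OF fin(2) L(1)] by (simp add: card_Diff_subset finite_subset)
      obtain w where w: "card W = Suc w"
        using W(2) by (metis card_0_eq minimal_zero_def not0_implies_Suc)
      obtain z where z: "card N = Suc z"
        using False fin by (metis card_0_eq not0_implies_Suc)
      \<comment> \<open>Both factors are positive, so their product is at least
        \<open>card W + card N - 1\<close>, and \<open>card L\<close> is at most p - 1.\<close>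
      have "m \<le> card W * card N + (card Q - card L - card W) + 1"
        using w z le L(3) assms(4) cardI by simp
      then show ?thesis using finish L W by blast
    next
      case True
      then have cQ: "card Q + 1 \<ge> m + p" using cardI assms(4) by simp
      have "m \<ge> 2 * p + 1" using divisor_large(2)[of m] assms(1,2) by simp
      then have "\<exists>R B. R \<subseteq> Q \<and> card R = p \<and> (\<forall>i\<in>R. i \<in> B i \<and> B i \<subseteq> Q \<and> card (B i) = 2 \<and> inj_on c (B i))
        \<and> (\<forall>i\<in>R. \<forall>j\<in>R. i \<noteq> j \<longrightarrow> B i \<inter> B j = {})"
      proof (intro pair_blocks)
        fix i assume i: "i \<in> Q"
        have "card {j \<in> Q. c j = c i} \<le> card {j \<in> I. c j = c i}"
          using assms(3) by (intro card_mono) (auto simp: Q_def)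
        then show "card {j \<in> Q. c j = c i} < p" using cls[of i] i by (simp add: Q_def)
      qed (use fin cQ in auto)
      then obtain R B where R: "R \<subseteq> Q" "card R = p"
        and B: "\<And>i. i \<in> R \<Longrightarrow> B i \<subseteq> Q \<and> card (B i) = 2 \<and> inj_on c (B i) \<and> i \<in> B i"
        and disj: "\<And>i j. i \<in> R \<Longrightarrow> j \<in> R \<Longrightarrow> i \<noteq> j \<Longrightarrow> B i \<inter> B j = {}"
        by (elim exE conjE) blast
      \<comment> \<open>Of the \<open>p\<close> pairs, \<open>h\<close> supply an \<open>L\<close>
        with the class of \<open>Q\<close>, and \<open>h\<close> supply a \<open>V\<close>
        cancelling the class of one element \<open>x\<close> of the last pair. Then
        \<open>card L + card W\<close> is at most h + (h + 1) = p.\<close>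
      define h where "h = p div 2"
      have h: "p = 2 * h + 1" using assms(1) by (auto simp: h_def elim: oddE)
      obtain R1 where R1: "R1 \<subseteq> R" "card R1 = h" "finite R1"
        using obtain_subset_with_card_n[of h R] R(2) h by auto
      have "card (R - R1) = h + 1" using R1 R(2) h by (simp add: card_Diff_subset)
      then obtain R2 where R2: "R2 \<subseteq> R - R1" "card R2 = h" "finite R2"
        using obtain_subset_with_card_n[of h "R - R1"] by auto
      have "card (R - R1 - R2) = 1"
        using \<open>card (R - R1) = h + 1\<close> R2 by (simp add: card_Diff_subset)
      then obtain x where x: "x \<in> R - R1 - R2" by (metis card_1_singletonE insertI1)
      have B0: "card (B i) = 2 \<and> inj_on c (B i) \<and> 0 \<notin> c ` B i" if "i \<in> R" for i
      proof -
        have "c k \<noteq> 0" if "k \<in> Q" for k using that by (simp add: Q_def)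
        then have "0 \<notin> c ` Q" by fastforce
        moreover have "c ` B i \<subseteq> c ` Q" using B[OF that] by (intro image_mono) (elim conjE)
        ultimately show ?thesis using B[OF that] by (meson subsetD)
      qed
      have "\<exists>L\<subseteq>(\<Union>i\<in>R1. B i). card L \<le> card R1 \<and> [int (sum c Q) = int (sum c L)] (mod int p)"
        by (rule pair_sums, use R1 in simp, use R1 B0 in blast, use R1 disj in blast, use R1 h in simp)
      then obtain L where L: "L \<subseteq> (\<Union>i\<in>R1. B i)" "card L \<le> h" "[sum c Q = sum c L] (mod p)"
        using R1(2) cong_int_iff by metis
      have "\<exists>V\<subseteq>(\<Union>i\<in>R2. B i). card V \<le> card R2 \<and> [- int (c x) = int (sum c V)] (mod int p)"
        by (rule pair_sums, use R2 in simp, use R2 B0 in blast, use R2 disj in blast, use R2 h in simp)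
      then obtain V where V: "V \<subseteq> (\<Union>i\<in>R2. B i)" "card V \<le> h" "[- int (c x) = int (sum c V)] (mod int p)"
        using R2(2) by metis
      have LQ: "L \<subseteq> Q" using L(1) B R1(1) by blast
      have VQ: "V \<subseteq> Q" using V(1) B R2(1) by blast
      have finLV: "finite L" "finite V" using LQ VQ fin(2) finite_subset by blast+
      have xV: "x \<notin> V"
      proof
        assume "x \<in> V"
        then obtain i where "i \<in> R2" "x \<in> B i" using V(1) by blast
        then show False using disj[of i x] B[of x] x R2(1) by blast
      qed
      have disjL: "insert x V \<inter> L = {}"
      proof -
        have "y \<notin> insert x V" if "y \<in> L" for y
        proof -
          obtain i where i: "i \<in> R1" "y \<in> B i" using L(1) \<open>y \<in> L\<close> by blast
          have "y \<notin> B j" if "j \<in> R - R1" for j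
            using disj[of i j] i that R1(1) by blast
          then show ?thesis using V(1) R2(1) x B[of x] by blast
        qed
        then show ?thesis by blast
      qed
      have xQ: "x \<in> Q" using x R by blast
      have "int (sum c (insert x V)) = int (c x) + int (sum c V)" using xV finLV by simp
      moreover have "int p dvd int (c x) + int (sum c V)"
      proof -
        have "int p dvd - int (c x) - int (sum c V)" using V(3) by (simp add: cong_iff_dvd_diff)
        then show ?thesis by (metis dvd_minus_iff minus_add_distrib uminus_add_conv_diff diff_conv_add_uminus add.commute)
      qed
      ultimately have "p dvd sum c (insert x V)" by (metis int_dvd_int_iff)
      then obtain W where W: "W \<subseteq> insert x V" "minimal_zero W"
        using minimal_zero_exists[of "insert x V"] finLV by blast
      have "card W \<le> card (insert x V)" using W(1) finLV by (intro card_mono) auto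
      then have cW: "card W \<le> h + 1" using V(2) xV finLV by simp
      have "sum c Q = sum c (Q - L) + sum c L" using fin LQ by (intro sum.subset_diff) auto
      then have "[sum c (Q - L) + sum c L = sum c L] (mod p)" using L(3) by simp
      then have "p dvd sum c (Q - L)" by (simp add: cong_add_rcancel_0_nat cong_0_iff)
      moreover have "W \<subseteq> Q - L" using W(1) VQ xQ disjL by blast
      moreover have "m \<le> card W * card N + (card Q - card L - card W) + 1"
        using cQ cW L(2) h by simp
      moreover have "card L < p" using L(2) h by simp
      ultimately show ?thesis using finish LQ W(2) by blast
    qed
  qed
qed

section \<open>Product-one sequences of length pm\<close>

lemma attains_zero_classes:
  assumes "finite T" "\<And>i. i \<in> T \<Longrightarrow> c i = 0" "int m dvd (\<Sum>i\<in>T. b i)"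
  shows "attains T 0"
proof -
  have "attains (\<Union>i\<in>T. {i}) (\<Sum>i\<in>T. b i)"
    using assms by (intro attains_Union attains_singleton) auto
  then show ?thesis using assms(3) attains_cong[of T "\<Sum>i\<in>T. b i" 0] by (simp add: cong_0_iff)
qed

text \<open>The suffix of length \<open>x\<close> has class x k, and these run through all residues
  modulo the prime \<open>p\<close>.\<close>

lemma suffix_sum_pure:
  assumes "\<And>i. i \<in> set l \<Longrightarrow> c i = k" "k \<noteq> 0" "k < p" "length l = p"
  shows "suffix_sum l j"
proof -
  have "\<not> p dvd k" using assms(2,3) by (simp add: nat_dvd_not_less)
  then have "coprime k p" using prime_p by (metis coprime_commute prime_imp_coprime)
  then obtain x0 where x0: "[k * x0 = 1] (mod p)" using cong_solve_coprime_nat by auto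
  define x where "x = (x0 * j) mod p"
  have "x < p" using p_gt_1 by (simp add: x_def)
  have "[x * k = (x0 * j) * k] (mod p)"
    unfolding x_def by (intro cong_mult) (simp_all add: cong_def)
  moreover have "[(x0 * j) * k = 1 * j] (mod p)"
    using cong_mult[OF x0 cong_refl[of j]] by (simp add: algebra_simps)
  ultimately have xk: "[x * k = j] (mod p)" using cong_trans by fastforce
  have csum_pure: "csum v = length v * k" if "set v \<subseteq> set l" for v
    using that assms(1) by (induction v) auto
  have "csum (drop (p - x) l) = x * k"
    using csum_pure[OF set_drop_subset, of "p - x"] assms(4) \<open>x < p\<close> by simp
  then show ?thesis
    unfolding suffix_sum_def using xk
    by (intro exI[of _ "take (p - x) l"] exI[of _ "drop (p - x) l"]) simp
qed

text \<open>The \<open>p\<close> terms of one nonzero class form a host \<open>l\<close> in which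
  every power of \<open>r\<close> is available. The other terms are cut into blocks of length
  \<open>p\<close> and class 0, and \<open>block_selection\<close> picks the right number of
  them.\<close>

lemma product_one_pure_class:
  assumes fin: "finite I" and card_I: "card I + 2 = p * m + m + p"
    and i0: "i0 \<in> I" "c i0 \<noteq> 0" "card {j \<in> I. c j = c i0} \<ge> p"
  shows "\<exists>T\<subseteq>I. card T = p * m \<and> attains T 0"
proof -
  define q where "q = (m - 1) div p"
  have q: "m = q * p + 1" using p_dvd_m_minus_1 m_pos by (simp add: q_def)
  obtain C where C: "C \<subseteq> {j \<in> I. c j = c i0}" "card C = p" "finite C"
    using obtain_subset_with_card_n[OF i0(3)] by blast
  obtain l where l: "set l = C" "distinct l" using finite_distinct_list C(3) by blast
  have len: "length l = p" using l C(2) distinct_card by metis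
  have suf: "suffix_sum l j" for j
    using C(1) l(1) len i0(2) c_less by (intro suffix_sum_pure[where k = "c i0"]) auto
  have "csum l = sum c C" using csum_distinct l by metis
  also have "\<dots> = p * c i0" using C by (simp add: subset_iff)
  finally have zl: "p dvd csum l" by simp
  have card_IC: "card (I - C) + p = card I"
    using C fin card_mono[of I C] by (simp add: card_Diff_subset subset_iff)
  have "\<exists>R B. R \<subseteq> I - C \<and> card R = (m - 1) + q
      \<and> (\<forall>i\<in>R. i \<in> B i \<and> B i \<subseteq> I - C \<and> card (B i) = p \<and> p dvd sum c (B i))
      \<and> (\<forall>i\<in>R. \<forall>j\<in>R. i \<noteq> j \<longrightarrow> B i \<inter> B j = {})"
  proof (rule disjoint_blocks[where N = "2 * p - 1"])
    fix E assume E: "E \<subseteq> I - C" "2 * p - 1 \<le> card E"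
    have "finite E" using E(1) fin finite_subset by blast
    then obtain B where "B \<subseteq> E" "card B = p" "int p dvd (\<Sum>i\<in>B. int (c i))"
      using erdos_ginzburg_ziv_prime[OF prime_p _ E(2)] by blast
    then show "\<exists>B\<subseteq>E. card B = p \<and> p dvd sum c B" by (metis int_dvd_int_iff of_nat_sum)
  next
    \<comment> \<open>Equality holds here, because q p = m - 1; this is where the full length p m +
      m + p - 2 is used.\<close>
    show "(m - 1 + q) * p + (2 * p - 1) \<le> card (I - C) + p"
      using card_IC card_I q p_gt_1 by (simp add: algebra_simps)
  qed (use fin p_gt_1 in auto)
  then obtain R B where R: "R \<subseteq> I - C" "card R = (m - 1) + q"
    and B': "\<forall>i\<in>R. i \<in> B i \<and> B i \<subseteq> I - C \<and> card (B i) = p \<and> p dvd sum c (B i)"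
    and disj': "\<forall>i\<in>R. \<forall>j\<in>R. i \<noteq> j \<longrightarrow> B i \<inter> B j = {}"
    by (elim exE conjE)
  note B = B'[rule_format] and disj = disj'[rule_format]
  have finR: "finite R" using R fin finite_subset by blast
  have finB: "finite (B i)" if "i \<in> R" for i
    using B[OF that] fin finite_subset by blast
  have "\<forall>i\<in>R. \<exists>t. attains (B i) t" using attains_exists finB B by blast
  then obtain a where a: "\<And>i. i \<in> R \<Longrightarrow> attains (B i) (a i)" by metis
  have card_UB: "card (\<Union>i\<in>T. B i) = card T * p" if "T \<subseteq> R" for T
  proof -
    have "card (\<Union>i\<in>T. B i) = (\<Sum>i\<in>T. card (B i))"
      using that finB disj finite_subset[OF that finR] by (intro card_UN_disjoint) (auto, blast)
    also have "\<dots> = (\<Sum>i\<in>T. p)" using that B by (intro sum.cong) auto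
    finally show ?thesis by simp
  qed
  \<comment> \<open>Either \<open>m\<close> blocks alone, or \<open>m - 1\<close> blocks inserted
    into the \<open>p\<close> terms of \<open>l\<close>: both have p m terms.\<close>
  consider (plain) T where "T \<subseteq> R" "card T = m" "int m dvd (\<Sum>i\<in>T. a i)"
    | (signed) T e where "T \<subseteq> R" "card T = m - 1" "int m dvd wsum l + (\<Sum>i\<in>T. r ^ e i * a i)"
    using block_selection[OF finR, of a "wsum l"] R(2) unfolding q_def by blast
  then show ?thesis
  proof cases
    case plain
    have "attains (\<Union>i\<in>T. B i) (\<Sum>i\<in>T. a i)"
      using plain(1) finite_subset[OF plain(1) finR] a disj by (intro attains_Union) blast+
    then have "attains (\<Union>i\<in>T. B i) 0"
      using plain(3) by (intro attains_cong[of _ "\<Sum>i\<in>T. a i" 0]) (simp_all add: cong_0_iff)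
    moreover have "(\<Union>i\<in>T. B i) \<subseteq> I" using B plain(1) by blast
    ultimately show ?thesis using card_UB[OF plain(1)] plain(2)
      by (intro exI[of _ "\<Union>i\<in>T. B i"]) simp
  next
    case signed
    let ?U = "set l \<union> (\<Union>i\<in>T. B i)"
    have "attains ?U (wsum l + (\<Sum>i\<in>T. r ^ e i * a i))"
    proof (rule attains_insert_blocks)
      show "finite T" using finite_subset[OF signed(1) finR] .
      show "attains (B k) (a k)" if "k \<in> T" for k using a signed(1) that by blast
      show "B k \<inter> set l = {}" if "k \<in> T" for k using B[of k] l signed(1) that by blast
      show "B k \<inter> B k' = {}" if "k \<in> T" "k' \<in> T" "k \<noteq> k'" for k k'
        using disj signed(1) that by blast
    qed (use l zl suf in auto)
    then have "attains ?U 0" using attains_cong signed(3) by (metis cong_0_iff)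
    moreover have "?U \<subseteq> I" using B signed(1) l C by blast
    moreover have "card ?U = card (set l) + card (\<Union>i\<in>T. B i)"
      using B l signed(1) finB finite_subset[OF signed(1) finR] by (intro card_Un_disjoint) auto
    then have "card ?U = p + (m - 1) * p"
      using card_UB[OF signed(1)] signed(2) l C(2) by simp
    moreover have "p + (m - 1) * p = p * m"
    proof -
      obtain n where "m = Suc n" using m_pos by (metis Suc_le_D One_nat_def)
      then show ?thesis by simp
    qed
    ultimately show ?thesis by (intro exI[of _ ?U]) simp
  qed
qed

text \<open>At most (p - 1)^2 terms have nonzero class, so terms of class 0 dominate, and the cases
  are distinguished by how their exponents \<open>b\<close> spread over the subgroups of
  Z/m.\<close>

lemma product_one_small_classes:
  assumes fin: "finite I" and card_I: "card I + 2 = p * m + m + p" and "m > 1"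
    and cls: "\<And>i. i \<in> I \<Longrightarrow> c i \<noteq> 0 \<Longrightarrow> card {j \<in> I. c j = c i} < p"
    and many: "card {i \<in> I. c i \<noteq> 0} \<ge> p"
  shows "\<exists>T\<subseteq>I. card T = p * m \<and> attains T 0"
proof -
  define N where "N = {i \<in> I. c i = 0}"
  define Q where "Q = {i \<in> I. c i \<noteq> 0}"
  have finNQ: "finite N" "finite Q" using fin by (simp_all add: N_def Q_def)
  have IQ: "I = N \<union> Q" "N \<inter> Q = {}" by (auto simp: N_def Q_def)
  then have cardI: "card I = card N + card Q" using finNQ by (simp add: card_Un_disjoint)
  have Qp: "card Q \<ge> p" using many by (simp add: Q_def)
  have "card Q \<le> (\<Sum>k\<in>{1..<p}. card {i \<in> I. c i = k})"
  proof -
    have "Q \<subseteq> (\<Union>k\<in>{1..<p}. {i \<in> I. c i = k})" using c_less by (auto simp: Q_def)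
    then have "card Q \<le> card (\<Union>k\<in>{1..<p}. {i \<in> I. c i = k})"
      using fin by (intro card_mono) auto
    also have "\<dots> \<le> (\<Sum>k\<in>{1..<p}. card {i \<in> I. c i = k})" by (rule card_UN_le) simp
    finally show ?thesis .
  qed
  also have "\<dots> \<le> (\<Sum>k\<in>{1..<p}. p - 1)"
  proof (rule sum_mono)
    fix k assume k: "k \<in> {1..<p}"
    show "card {i \<in> I. c i = k} \<le> p - 1"
    proof (cases "\<exists>i\<in>I. c i = k")
      case True
      then show ?thesis using cls k by fastforce
    next
      case False
      then have "{i \<in> I. c i = k} = {}" by blast
      then show ?thesis by (metis card.empty le0)
    qed
  qed
  finally have sq: "card Q \<le> (p - 1) * (p - 1)" by simp
  \<comment> \<open>For \<open>p = 2\<close> the bound would leave at most one term of nonzero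
    class, fewer than the \<open>p\<close> that exist.\<close>
  have "p \<noteq> 2" using sq Qp by auto
  then have "odd p" using prime_p p_gt_1 by (metis prime_odd_nat nat_less_le One_nat_def Suc_1 Suc_leI)
  then have mbig: "m \<ge> 2 * p + 1" using divisor_large(2)[of m] \<open>m > 1\<close> by simp
  obtain p' where p': "p = Suc p'" using p_gt_1 by (cases p) auto
  have pm1: "(p - 1) * (p - 1) \<le> (p - 1) * m" using mbig by (intro mult_le_mono2) simp
  have pm2: "p * m = (p - 1) * m + m" using p' by simp
  define out where "out d = {i \<in> N. \<not> int d dvd b i}" for d
  consider (proper) d where "d dvd m" "d > 1" "d \<noteq> m" "card (out d) + 2 \<le> d"
    | (dense) "\<And>d. d dvd m \<Longrightarrow> d > 1 \<Longrightarrow> d \<le> card (out d) + 1"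
    | (only) "card (out m) + 2 \<le> m"
    by fastforce
  then show ?thesis
  proof cases
    case proper
    obtain e where e: "m = d * e" using proper(1) by blast
    have "e \<noteq> 0" using e m_pos by (cases e) auto
    then have "e > 1" using e proper(3) by (cases "e = 1") auto
    have "d \<ge> 2 * p + 1" "e \<ge> 2 * p + 1"
      using divisor_large(2)[OF _ _ \<open>odd p\<close>] proper e \<open>e > 1\<close> by auto
    then obtain x y where xy: "d = 2 * p + 1 + x" "e = 2 * p + 1 + y" using le_Suc_ex by metis
    \<comment> \<open>Removing the terms of nonzero class and at most d - 2 others must leave p m +
      e - 1 terms with exponent in dZ.\<close>
    have "(p - 1) * (p - 1) + d + e \<le> m + p + 1"
      unfolding e xy p' by (simp add: algebra_simps)
    define Nd where "Nd = {i \<in> N. int d dvd b i}"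
    have "N - Nd = out d" "Nd \<subseteq> N" by (auto simp: Nd_def out_def)
    then have "card N = card Nd + card (out d)"
      using finNQ by (metis card_Diff_subset card_mono finite_subset le_add_diff_inverse)
    then have "card Nd + 1 \<ge> p * m + e"
      using \<open>(p - 1) * (p - 1) + d + e \<le> m + p + 1\<close> sq card_I cardI proper(4) by linarith
    then have "\<exists>T\<subseteq>Nd. card T = p * m \<and> int m dvd (\<Sum>i\<in>T. b i)"
      by (rule erdos_ginzburg_ziv_divisible[OF e m_pos, rotated -1]) (use finNQ in \<open>simp_all add: Nd_def\<close>)
    then obtain T where T: "T \<subseteq> Nd" "card T = p * m" "int m dvd (\<Sum>i\<in>T. b i)" by blast
    have TN: "T \<subseteq> N" using T(1) \<open>Nd \<subseteq> N\<close> by blast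
    then have "attains T 0"
      using T(3) finite_subset[OF TN finNQ(1)] by (intro attains_zero_classes) (auto simp: N_def)
    then show ?thesis using T(2) TN IQ by blast
  next
    case dense
    obtain L where L: "L \<subseteq> Q" "p dvd sum c (Q - L)" "card L < p"
      using zero_complement[OF finNQ(2)] by blast
    define W where "W = Q - L"
    have finW: "finite W" using finNQ by (simp add: W_def)
    have cW: "card W + card L = card Q"
      using L(1) finNQ card_mono[OF finNQ(2) L(1)] by (simp add: W_def card_Diff_subset finite_subset)
    then have "W \<noteq> {}" using L(3) Qp by auto
    obtain l where l: "set l = W" "distinct l" using finite_distinct_list[OF finW] by blast
    \<comment> \<open>The last term \<open>z\<close> makes \<open>c z\<close> a suffix class: a term
      of \<open>N\<close> goes either in front of \<open>z\<close> with factor r^(c z) or to the end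
      with factor 1.\<close>
    then obtain l' z where lz: "l = l' @ [z]" using \<open>W \<noteq> {}\<close> by (metis rev_exhaust set_empty)
    have "z \<in> Q" using l lz by (auto simp: W_def)
    have suf: "suffix_sum l (c z)"
      unfolding suffix_sum_def using lz by (intro exI[of _ l'] exI[of _ "[z]"]) simp
    have zl: "p dvd csum l" using csum_distinct[OF l(2)] l(1) L(2) by (simp add: W_def)
    have "\<not> [c z = 0] (mod p)"
      using \<open>z \<in> Q\<close> c_less[of z] by (simp add: Q_def cong_def)
    then have cop: "coprime (r ^ c z - 1) (int m)" using coprime_r_pow_diff[of "c z" 0] by simp
    have "\<exists>I'\<subseteq>N. card I' < m \<and> (\<forall>t. \<exists>F\<subseteq>I'. [t = (\<Sum>i\<in>F. (r ^ c z - 1) * b i)] (mod int m))"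
      using dense by (intro subset_sums_cover finNQ m_pos cop) (simp add: out_def)
    then obtain N' where N': "N' \<subseteq> N" "card N' < m"
      "\<And>t. \<exists>F\<subseteq>N'. [t = (\<Sum>i\<in>F. (r ^ c z - 1) * b i)] (mod int m)" by blast
    \<comment> \<open>Exactly \<open>k\<close> terms of \<open>N\<close> complete \<open>W\<close>
      to length p m; the fewer than \<open>m\<close> elements of \<open>N'\<close> must be among
      them.\<close>
    define k where "k = p * m - card W"
    have Wle: "card W + m \<le> p * m" using cW sq pm1 pm2 by linarith
    have "card N' \<le> k" "k \<le> card N"
      using N'(2) Wle cW L(3) card_I cardI by (auto simp: k_def)
    then obtain T where T: "N' \<subseteq> T" "T \<subseteq> N" "card T = k"
      using exists_subset_between[of N' k N] N'(1) finNQ by blast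
    obtain F where F: "F \<subseteq> N'" "[- wsum l - (\<Sum>i\<in>T. b i) = (\<Sum>i\<in>F. (r ^ c z - 1) * b i)] (mod int m)"
      using N'(3) by blast
    have finT: "finite T" using T finNQ finite_subset by blast
    let ?e = "\<lambda>i. if i \<in> F then c z else 0"
    have "(\<Sum>i\<in>T. r ^ ?e i * b i) = (\<Sum>i\<in>T. b i + (if i \<in> F then (r ^ c z - 1) * b i else 0))"
      by (rule sum.cong) (auto simp: algebra_simps)
    also have "\<dots> = (\<Sum>i\<in>T. b i) + (\<Sum>i\<in>F. (r ^ c z - 1) * b i)"
      using F(1) T(1) finT by (simp add: sum.distrib sum.If_cases inf.absorb2 subset_trans)
    finally have "wsum l + (\<Sum>i\<in>T. r ^ ?e i * b i)
      = - (- wsum l - (\<Sum>i\<in>T. b i) - (\<Sum>i\<in>F. (r ^ c z - 1) * b i))"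
      by simp
    then have dvd: "int m dvd wsum l + (\<Sum>i\<in>T. r ^ ?e i * b i)"
      using F(2) by (simp only: cong_iff_dvd_diff dvd_minus_iff)
    have NW: "N \<inter> W = {}" using IQ by (auto simp: W_def)
    have "attains (set l \<union> (\<Union>i\<in>T. {i})) (wsum l + (\<Sum>i\<in>T. r ^ ?e i * b i))"
    proof (rule attains_insert_blocks)
      show "attains {i} (b i)" if "i \<in> T" for i
        using that T(2) by (intro attains_singleton) (auto simp: N_def)
      show "{i} \<inter> set l = {}" if "i \<in> T" for i using that T(2) NW l(1) by blast
      show "suffix_sum l (?e i)" for i using suf suffix_sum_0 by simp
    qed (use finT l zl in auto)
    then have "attains (W \<union> T) 0"
      using dvd attains_cong[of "W \<union> T" "wsum l + (\<Sum>i\<in>T. r ^ ?e i * b i)" 0] l(1)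
      by (simp add: cong_0_iff)
    moreover have "card (W \<union> T) = p * m"
    proof -
      have "W \<inter> T = {}" using T(2) NW by blast
      then have "card (W \<union> T) = card W + card T" using finW finT by (intro card_Un_disjoint)
      then show ?thesis using T(3) Wle by (simp add: k_def)
    qed
    moreover have "W \<union> T \<subseteq> I" using T(2) IQ by (auto simp: W_def)
    ultimately show ?thesis by blast
  next
    case only
    \<comment> \<open>These indices stand for the identity, so any number of them can be added to a
      product-one set.\<close>
    define Z where "Z = {i \<in> N. int m dvd b i}"
    have ZN: "N - Z = out m" "Z \<subseteq> N" "finite Z" using finNQ by (auto simp: Z_def out_def)
    then have cN: "card N = card Z + card (out m)"
      using finNQ by (metis card_Diff_subset card_mono le_add_diff_inverse)
    have att_Z: "attains Y 0" if "Y \<subseteq> Z" for Y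
    proof (rule attains_zero_classes)
      show "finite Y" using that ZN(3) finite_subset by blast
      show "c i = 0" if "i \<in> Y" for i using \<open>Y \<subseteq> Z\<close> that by (auto simp: Z_def N_def)
      show "int m dvd (\<Sum>i\<in>Y. b i)" using that by (intro dvd_sum) (auto simp: Z_def)
    qed
    have att_empty: "attains {} 0" using att_Z by blast
    define S where "S = I - Z"
    have finS: "finite S" using fin by (simp add: S_def)
    have cS: "card S + card Z = card I"
      using ZN IQ fin card_mono[of I Z] by (simp add: S_def card_Diff_subset subset_iff)
    define \<T> where "\<T> = {T. T \<subseteq> S \<and> attains T 0}"
    have "finite \<T>" "{} \<in> \<T>" using finS att_empty by (auto simp: \<T>_def)
    then obtain T where T: "T \<in> \<T>" "\<And>T'. T' \<in> \<T> \<Longrightarrow> T \<subseteq> T' \<Longrightarrow> T = T'"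
      using finite_has_maximal[of \<T>] by blast
    have TS: "T \<subseteq> S" "attains T 0" "finite T" using T(1) attains_finite by (auto simp: \<T>_def)
    \<comment> \<open>By maximality no product-one subset is left beside \<open>T\<close>, so
      \<open>exists_product_one_subset\<close> limits what remains to m + p - 2 terms. Hence
      \<open>T\<close> and the identities together number at least p m.\<close>
    have rest: "card (S - T) + 1 < m + p"
    proof (rule ccontr)
      assume "\<not> card (S - T) + 1 < m + p"
      moreover have "card {j \<in> S - T. c j = c i} < p" if "i \<in> S - T" "c i \<noteq> 0" for i
      proof -
        have "card {j \<in> S - T. c j = c i} \<le> card {j \<in> I. c j = c i}"
          using fin by (intro card_mono) (auto simp: S_def)
        then show ?thesis using cls[of i] that by (auto simp: S_def)
      qed
      ultimately obtain U where U: "U \<subseteq> S - T" "U \<noteq> {}" "attains U 0"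
        using exists_product_one_subset[OF \<open>odd p\<close> \<open>m > 1\<close>, of "S - T"] finS by auto
      have "attains (T \<union> U) (0 + 0)" using attains_Un[OF TS(2) U(3)] U(1) by blast
      then have "T \<union> U \<in> \<T>" using TS U by (auto simp: \<T>_def)
      then show False using T(2)[of "T \<union> U"] U by blast
    qed
    have "card (S - T) + card T = card S"
      using TS finS card_mono[of S T] by (simp add: card_Diff_subset)
    \<comment> \<open>\<open>S\<close> consists of \<open>Q\<close> and \<open>out m\<close>, at
      most (p - 1)^2 + m - 2 terms, so \<open>T\<close> does not exceed the desired length and
      identities fill it up.\<close>
    moreover have "card S \<le> p * m"
      using cS cardI cN only sq pm1 pm2 by linarith
    ultimately have "card T \<le> p * m" "p * m - card T \<le> card Z"
      using rest cS card_I by linarith+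
    then obtain Z' where Z': "Z' \<subseteq> Z" "card Z' = p * m - card T" "finite Z'"
      using obtain_subset_with_card_n by metis
    have dis: "T \<inter> Z' = {}" using TS Z' by (auto simp: S_def)
    have "attains (T \<union> Z') (0 + 0)" using attains_Un[OF TS(2) att_Z[OF Z'(1)] dis] .
    moreover have "card (T \<union> Z') = p * m"
      using card_Un_disjoint[OF TS(3) Z'(3) dis] Z'(2) \<open>card T \<le> p * m\<close> by simp
    moreover have "T \<union> Z' \<subseteq> I" using TS Z' ZN IQ by (auto simp: S_def)
    ultimately show ?thesis by (intro exI[of _ "T \<union> Z'"]) simp
  qed
qed

text \<open>With fewer than \<open>p\<close> terms of nonzero class, at least p m + m - 1 have class
  0 and \<open>erdos_ginzburg_ziv_multiple\<close> applies. The case \<open>m = 1\<close> is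
  separate because the argument for small classes relies on m >= 2p + 1; there only the classes
  matter.\<close>

theorem exists_product_one_of_order_length:
  assumes fin: "finite I" and card_I: "card I + 2 = p * m + m + p"
  shows "\<exists>T\<subseteq>I. card T = p * m \<and> attains T 0"
proof (cases "card {i \<in> I. c i \<noteq> 0} < p")
  case True
  define N where "N = {i \<in> I. c i = 0}"
  have "I = N \<union> {i \<in> I. c i \<noteq> 0}" by (auto simp: N_def)
  then have "card I \<le> card N + card {i \<in> I. c i \<noteq> 0}" by (metis card_Un_le)
  then have "card N + 1 \<ge> p * m + m" using card_I True by linarith
  then obtain T where T: "T \<subseteq> N" "card T = p * m" "int m dvd (\<Sum>i\<in>T. b i)"
    using erdos_ginzburg_ziv_multiple[OF m_pos, of N p b] fin by (auto simp: N_def)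
  then have "attains T 0"
    using finite_subset[of T I] fin by (intro attains_zero_classes) (auto simp: N_def)
  then show ?thesis using T by (auto simp: N_def)
next
  case many: False
  show ?thesis
  proof (cases "\<exists>i\<in>I. c i \<noteq> 0 \<and> card {j \<in> I. c j = c i} \<ge> p")
    case True
    then show ?thesis using product_one_pure_class[OF assms] by blast
  next
    case small: False
    show ?thesis
    proof (cases "m = 1")
      case True
      then have "card I \<ge> 2 * p - 1" using card_I by simp
      then obtain T where T: "T \<subseteq> I" "card T = p" "int p dvd (\<Sum>i\<in>T. int (c i))"
        using erdos_ginzburg_ziv_prime[OF prime_p fin] by blast
      have "p dvd sum c T" using T(3) by (metis int_dvd_int_iff of_nat_sum)
      then obtain t where "attains T t" using attains_exists finite_subset[OF T(1) fin] by blast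
      then have "attains T 0" using attains_cong[of T t 0] True by simp
      then show ?thesis using T True by auto
    next
      case False
      then have "m > 1" using m_pos by simp
      then show ?thesis using product_one_small_classes[OF assms] small many by (meson not_less)
    qed
  qed
qed

end

section \<open>The metacyclic group\<close>

lemma submultiset_of_size:
  assumes "n \<le> size S"
  shows "\<exists>T. T \<subseteq># S \<and> size T = n"
proof -
  obtain xs where xs: "mset xs = S" using ex_mset by blast
  have "S = mset (take n xs) + mset (drop n xs)"
    using xs by (metis append_take_drop_id mset_append)
  then have "mset (take n xs) \<subseteq># S" by simp
  moreover have "size (mset (take n xs)) = n" using assms xs by auto
  ultimately show ?thesis by blast
qed

locale metacyclic_group = group G for G (structure) +
  fixes p m :: nat and r :: int and x y
  assumes prime_p: "Factorial_Ring.prime p" and m_ge_1: "m \<ge> 1"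
    and r_pow: "[r ^ p = 1] (mod int m)"
    and coprime_r: "coprime (r - 1) (int m)"
    and x_carrier: "x \<in> carrier G" and y_carrier: "y \<in> carrier G"
    and x_pow_p: "x [^] p = \<one>" and y_pow_m: "y [^] m = \<one>"
    and conj_y: "inv x \<otimes> y \<otimes> x = y [^] r"
    and generated: "generate G {x, y} = carrier G"
    and order_G: "order G = p * m"
begin

definition elt :: "nat \<Rightarrow> int \<Rightarrow> 'a" where
  "elt k j = x [^] k \<otimes> y [^] j"

lemma elt_carrier [simp]: "elt k j \<in> carrier G"
  using x_carrier y_carrier by (simp add: elt_def)

lemma y_int_pow_x: "y [^] (j::int) \<otimes> x = x \<otimes> y [^] (j * r)"
proof -
  have hom: "(\<lambda>g. inv x \<otimes> g \<otimes> x) \<in> hom G G"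
  proof (rule homI)
    fix g h assume gh: "g \<in> carrier G" "h \<in> carrier G"
    have "x \<otimes> (inv x \<otimes> z) = z" if "z \<in> carrier G" for z
      using that x_carrier by (simp add: m_assoc[symmetric])
    with gh show "inv x \<otimes> (g \<otimes> h) \<otimes> x = (inv x \<otimes> g \<otimes> x) \<otimes> (inv x \<otimes> h \<otimes> x)"
      using x_carrier by (simp add: m_assoc)
  qed (use x_carrier in simp)
  have "inv x \<otimes> (y [^] j) \<otimes> x = (inv x \<otimes> y \<otimes> x) [^] j"
    using hom_int_pow[OF hom y_carrier is_group is_group] by simp
  also have "\<dots> = y [^] (j * r)"
    using y_carrier by (simp add: conj_y int_pow_pow mult.commute)
  finally have "x \<otimes> (inv x \<otimes> (y [^] j \<otimes> x)) = x \<otimes> y [^] (j * r)"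
    using x_carrier y_carrier by (simp add: m_assoc)
  then show ?thesis using x_carrier y_carrier by (simp add: m_assoc[symmetric])
qed

lemma y_int_pow_x_pow: "y [^] (j::int) \<otimes> x [^] (k::nat) = x [^] k \<otimes> y [^] (j * r ^ k)"
proof (induction k arbitrary: j)
  case 0
  then show ?case using y_carrier by simp
next
  case (Suc k)
  have "y [^] j \<otimes> x [^] Suc k = (y [^] j \<otimes> x [^] k) \<otimes> x"
    using x_carrier y_carrier by (simp add: m_assoc)
  also have "\<dots> = x [^] k \<otimes> (y [^] (j * r ^ k) \<otimes> x)"
    using Suc x_carrier y_carrier by (simp add: m_assoc)
  also have "\<dots> = x [^] k \<otimes> (x \<otimes> y [^] (j * r ^ k * r))"
    by (simp only: y_int_pow_x)
  also have "\<dots> = x [^] Suc k \<otimes> y [^] (j * r ^ Suc k)"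
    using x_carrier y_carrier by (simp add: m_assoc algebra_simps)
  finally show ?case .
qed

lemma elt_mult: "elt k j \<otimes> elt k' j' = elt (k + k') (j * r ^ k' + j')"
proof -
  have "elt k j \<otimes> elt k' j' = x [^] k \<otimes> (y [^] j \<otimes> x [^] k') \<otimes> y [^] j'"
    using x_carrier y_carrier by (simp add: elt_def m_assoc)
  also have "\<dots> = x [^] k \<otimes> x [^] k' \<otimes> (y [^] (j * r ^ k') \<otimes> y [^] j')"
    unfolding y_int_pow_x_pow using x_carrier y_carrier by (simp add: m_assoc)
  finally show ?thesis
    using x_carrier y_carrier by (simp add: elt_def nat_pow_mult int_pow_mult)
qed

lemma elt_cong:
  assumes "[k = k'] (mod p)" "[j = j'] (mod int m)"
  shows "elt k j = elt k' j'"
proof -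
  have "x [^] n = x [^] (n mod p)" for n
  proof -
    have "x [^] n = x [^] (p * (n div p) + n mod p)" by simp
    also have "\<dots> = x [^] (p * (n div p)) \<otimes> x [^] (n mod p)"
      by (rule nat_pow_mult[OF x_carrier, symmetric])
    also have "x [^] (p * (n div p)) = \<one>"
      using x_carrier by (simp add: nat_pow_pow[symmetric] x_pow_p)
    finally show ?thesis using x_carrier by simp
  qed
  moreover have "y [^] n = y [^] (n mod int m)" for n :: int
  proof -
    have "y [^] n = y [^] (int m * (n div int m) + n mod int m)" by simp
    also have "\<dots> = y [^] (int m * (n div int m)) \<otimes> y [^] (n mod int m)"
      using y_carrier by (rule int_pow_mult)
    also have "y [^] (int m * (n div int m)) = \<one>"
      using y_carrier by (simp add: int_pow_pow[symmetric] int_pow_int y_pow_m)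
    finally show ?thesis using y_carrier by simp
  qed
  ultimately show ?thesis using assms unfolding elt_def cong_def by metis
qed

lemma elt_0_0: "elt 0 0 = \<one>"
  by (simp add: elt_def)

lemma x_eq_elt: "x = elt 1 0" and y_eq_elt: "y = elt 0 1"
  using x_carrier y_carrier by (simp_all add: elt_def)

lemma elt_surj:
  assumes "g \<in> carrier G"
  shows "\<exists>k j. k < p \<and> 0 \<le> j \<and> j < int m \<and> g = elt k j"
proof -
  have p1: "p > 1" using prime_p by (rule prime_gt_1_nat)
  have "g \<in> generate G {x, y}" using assms generated by simp
  then have "\<exists>k j. g = elt k j"
  proof (induction rule: generate.induct)
    case one
    then show ?case using elt_0_0 by metis
  next
    case (incl h)
    then show ?case using x_eq_elt y_eq_elt by blast
  next
    case (inv h)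
    show ?case
    proof (cases "h = x")
      case True
      have "elt (p - 1) 0 \<otimes> x = elt p 0"
        using p1 elt_mult[of "p - 1" 0 1 0] x_eq_elt by simp
      also have "\<dots> = \<one>" using elt_cong[of p 0 0 0] elt_0_0 by (simp add: cong_def)
      finally have "inv x = elt (p - 1) 0" using x_carrier by (metis inv_equality elt_carrier)
      then show ?thesis using True by blast
    next
      case False
      then have "h = y" using inv by blast
      have "inv y = elt 0 (-1)" using y_carrier by (simp add: elt_def int_pow_neg)
      then show ?thesis using \<open>h = y\<close> by blast
    qed
  next
    case (eng h1 h2)
    then show ?case using elt_mult by metis
  qed
  then obtain k j where "g = elt k j" by blast
  then have "g = elt (k mod p) (j mod int m)"
    using elt_cong[of k "k mod p" j "j mod int m"] by (simp add: cong_def)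
  then show ?thesis using p1 m_ge_1
    by (intro exI[of _ "k mod p"] exI[of _ "j mod int m"]) simp
qed

text \<open>The p m normal forms cover the group, which has exactly p m elements, so the normal form
  is unique.\<close>

lemma elt_eq_one_iff: "elt k j = \<one> \<longleftrightarrow> p dvd k \<and> int m dvd j"
proof
  assume one: "elt k j = \<one>"
  let ?D = "{..<p} \<times> {0..<int m}"
  have "(\<lambda>(k, j). elt k j) ` ?D = carrier G"
    using elt_surj by (force simp: image_iff)
  then have "card ((\<lambda>(k, j). elt k j) ` ?D) = card ?D"
    using order_G by (simp add: order_def)
  then have inj: "inj_on (\<lambda>(k, j). elt k j) ?D" by (intro eq_card_imp_inj_on) auto
  have p0: "p > 0" using prime_p prime_gt_0_nat by blast
  have "elt (k mod p) (j mod int m) = elt 0 0"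
    using one elt_0_0 elt_cong[of k "k mod p" j "j mod int m"] by (simp add: cong_def)
  then have "(k mod p, j mod int m) = (0, 0)"
    using inj_onD[OF inj, of "(k mod p, j mod int m)" "(0, 0)"] p0 m_ge_1 by simp
  then show "p dvd k \<and> int m dvd j" by (auto simp: dvd_eq_mod_eq_0)
next
  assume "p dvd k \<and> int m dvd j"
  then show "elt k j = \<one>"
    using elt_cong[of k 0 j 0] elt_0_0 by (simp add: cong_0_iff)
qed

text \<open>The recursion of \<open>wsum\<close> is the rule \<open>elt_mult\<close>, which collects
  the powers of \<open>x\<close> on the left.\<close>

lemma list_prod_elt:
  assumes "\<And>i. c i < p"
  shows "list_prod G (map (\<lambda>i. elt (c i) (b i)) l)
    = elt (weighted_sequence.csum c l) (weighted_sequence.wsum r c b l)"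
proof -
  interpret weighted_sequence p m r c b
    using prime_p m_ge_1 r_pow coprime_r assms by unfold_locales
  show ?thesis
  proof (induction l)
    case Nil
    then show ?case by (simp add: list_prod_def elt_0_0)
  next
    case (Cons i l)
    have "list_prod G (map (\<lambda>i. elt (c i) (b i)) (i # l))
      = elt (c i) (b i) \<otimes> list_prod G (map (\<lambda>i. elt (c i) (b i)) l)"
      by (simp add: list_prod_def)
    then show ?case using Cons by (simp add: elt_mult)
  qed
qed

lemma product_one_subsequence:
  assumes "set_mset S \<subseteq> carrier G" "size S + 2 = p * m + m + p"
  shows "\<exists>T. T \<subseteq># S \<and> size T = order G \<and> product_one G T"
proof -
  obtain xs where xs: "mset xs = S" using ex_mset by blast
  \<comment> \<open>Positions in \<open>xs\<close> serve as indices. Positions beyond its end also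
    receive a value, since the locale demands \<open>c i < p\<close> for all indices.\<close>
  have "\<exists>k j. k < p \<and> (i < length xs \<longrightarrow> xs ! i = elt k j)" for i
  proof (cases "i < length xs")
    case True
    then have "xs ! i \<in> carrier G" using xs assms(1) by auto
    then show ?thesis using elt_surj by blast
  qed (use prime_p prime_gt_0_nat in blast)
  then obtain c b where cb: "\<And>i. c i < p" "\<And>i. i < length xs \<Longrightarrow> xs ! i = elt (c i) (b i)"
    by metis
  interpret weighted_sequence p m r c b
    using prime_p m_ge_1 r_pow coprime_r cb(1) by unfold_locales
  have "\<exists>T\<subseteq>{..<length xs}. card T = p * m \<and> attains T 0"
    using assms(2) xs by (intro exists_product_one_of_order_length) auto
  then obtain l where l: "set l \<subseteq> {..<length xs}" "card (set l) = p * m" "distinct l"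
    "p dvd csum l" "[wsum l = 0] (mod int m)"
    by (auto simp: attains_def)
  define T where "T = mset (map ((!) xs) l)"
  have "map ((!) xs) l = map (\<lambda>i. elt (c i) (b i)) l" using l(1) cb(2) by auto
  then have "list_prod G (map ((!) xs) l) = elt (csum l) (wsum l)"
    using list_prod_elt[of c b l, OF cb(1)] by (simp only:)
  also have "\<dots> = \<one>" using elt_eq_one_iff l(4,5) by (simp add: cong_0_iff)
  finally have "product_one G T"
    unfolding product_one_def prod_set_def T_def
    by (intro CollectI exI[of _ "map ((!) xs) l"]) simp
  moreover have "size T = order G" using l(2,3) distinct_card order_G by (fastforce simp: T_def)
  moreover have "T \<subseteq># S"
  proof -
    have "mset l = mset_set (set l)" using l(3) by (simp add: mset_set_set)
    also have "\<dots> \<subseteq># mset_set {..<length xs}"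
      using l(1) by (intro subset_imp_msubset_mset_set) auto
    finally have "image_mset ((!) xs) (mset l) \<subseteq># image_mset ((!) xs) (mset_set {..<length xs})"
      by (rule image_mset_subseteq_mono)
    moreover have "image_mset ((!) xs) (mset_set {..<length xs}) = S"
      using xs by (metis atLeast_upt map_nth mset_map mset_upt atLeast0LessThan)
    ultimately show ?thesis by (simp add: T_def)
  qed
  ultimately show ?thesis by blast
qed

section \<open>Padding with identities, the extremal sequence, and the two constants\<close>

lemma list_prod_filter_one:
  assumes "set xs \<subseteq> carrier G"
  shows "list_prod G (filter (\<lambda>g. g \<noteq> \<one>) xs) = list_prod G xs \<and> list_prod G xs \<in> carrier G"
  using assms by (induction xs) (auto simp: list_prod_def)

text \<open>Deleting the identities from a product-one \<open>T\<close> leaves a product-one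
  subsequence of \<open>S\<close>. It is nonempty because \<open>T\<close> is longer than the
  padding.\<close>

lemma product_one_free_padding:
  assumes "set_mset S \<subseteq> carrier G" "product_one_free G S" "T \<subseteq># replicate_mset k \<one> + S" "size T > k"
  shows "\<not> product_one G T"
proof
  assume "product_one G T"
  then obtain zs where zs: "mset zs = T" "list_prod G zs = \<one>"
    by (auto simp: product_one_def prod_set_def)
  have "set_mset T \<subseteq> insert \<one> (set_mset S)"
    using set_mset_mono[OF assms(3)] by (auto split: if_splits)
  then have "set zs \<subseteq> carrier G" using zs(1) assms(1) by auto
  define T' where "T' = filter_mset (\<lambda>g. g \<noteq> \<one>) T"
  have "list_prod G (filter (\<lambda>g. g \<noteq> \<one>) zs) = \<one>"
    using list_prod_filter_one[OF \<open>set zs \<subseteq> carrier G\<close>] zs(2) by simp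
  moreover have "mset (filter (\<lambda>g. g \<noteq> \<one>) zs) = T'" using zs(1) by (simp add: T'_def)
  ultimately have po: "product_one G T'"
    unfolding product_one_def prod_set_def
    by (intro CollectI exI[of _ "filter (\<lambda>g. g \<noteq> \<one>) zs"]) simp
  have sub: "T' \<subseteq># S"
  proof (rule mset_subset_eqI)
    fix g
    have "count T g \<le> count (replicate_mset k \<one> + S) g"
      using assms(3) by (rule mset_subset_eq_count)
    then show "count T' g \<le> count S g" by (auto simp: T'_def)
  qed
  have "T' \<noteq> {#}"
  proof
    assume "T' = {#}"
    moreover have "set_mset T' = {g \<in> set_mset T. g \<noteq> \<one>}" by (simp add: T'_def)
    ultimately have "set_mset T \<subseteq> {\<one>}" by auto
    then have T: "T = replicate_mset (size T) \<one>" by (metis set_mset_subset_singletonD size_replicate_mset)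
    \<comment> \<open>An identity in \<open>S\<close> would be a product-one subsequence of length
      1. So all identities in \<open>T\<close> come from the padding, at most \<open>k\<close> of
      them.\<close>
    have "\<one> \<notin># S"
    proof
      assume "\<one> \<in># S"
      then have "{#\<one>#} \<subseteq># S" by simp
      moreover have "product_one G {#\<one>#}"
        unfolding product_one_def prod_set_def
        by (intro CollectI exI[of _ "[\<one>]"]) (simp add: list_prod_def)
      moreover have "{#\<one>#} \<noteq> {#}" by simp
      ultimately show False using assms(2) unfolding product_one_free_def by blast
    qed
    then have "count S \<one> = 0" by (simp add: not_in_iff)
    moreover have "count T \<one> \<le> count (replicate_mset k \<one> + S) \<one>"
      using assms(3) by (rule mset_subset_eq_count)
    moreover have "count T \<one> = size T" by (subst T) simp
    ultimately show False using assms(4) by simp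
  qed
  then show False using assms(2) po sub by (auto simp: product_one_free_def)
qed

text \<open>The class of a product counts its factors \<open>x\<close> modulo \<open>p\<close>.
  Fewer than \<open>p\<close> are available, so a product-one subsequence has none, and then fewer
  than \<open>m\<close> factors \<open>y\<close> cannot multiply to the identity.\<close>

lemma extremal_product_one_free:
  "product_one_free G (replicate_mset (m - 1) y + replicate_mset (p - 1) x)"
  unfolding product_one_free_def
proof
  let ?S = "replicate_mset (m - 1) y + replicate_mset (p - 1) x"
  assume "\<exists>T. T \<subseteq># ?S \<and> T \<noteq> {#} \<and> product_one G T"
  then obtain zs where zs: "mset zs \<subseteq># ?S" "zs \<noteq> []" "list_prod G zs = \<one>"
    by (auto simp: product_one_def prod_set_def)
  have p1: "p > 1" using prime_p by (rule prime_gt_1_nat)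
  have "x \<noteq> y"
  proof
    assume "x = y"
    then have "elt (p - 1) 0 \<otimes> elt 0 1 = elt (p - 1) 0 \<otimes> elt 1 0" using x_eq_elt y_eq_elt by simp
    then have "elt (p - 1) 1 = elt p 0" using p1 by (simp add: elt_mult)
    also have "\<dots> = \<one>" using elt_eq_one_iff by simp
    finally have "p dvd p - 1" using elt_eq_one_iff by blast
    then show False using p1 by (simp add: nat_dvd_not_less)
  qed
  define c where "c g = (if g = x then 1 else 0::nat)" for g
  define b where "b g = (if g = x then 0 else 1::int)" for g
  interpret weighted_sequence p m r c b
    using prime_p m_ge_1 r_pow coprime_r p1 by unfold_locales (auto simp: c_def)
  have "set zs \<subseteq> set_mset ?S" using set_mset_mono[OF zs(1)] by simp
  then have set_zs: "set zs \<subseteq> {x, y}" by (auto split: if_splits)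
  have "map (\<lambda>g. elt (c g) (b g)) zs = zs"
    using set_zs \<open>x \<noteq> y\<close> x_eq_elt y_eq_elt by (intro map_idI) (auto simp: c_def b_def)
  then have "elt (csum zs) (wsum zs) = \<one>"
    using list_prod_elt[of c b zs] zs(3) c_less by simp
  then have dvd: "p dvd csum zs" "int m dvd wsum zs" using elt_eq_one_iff by auto
  have c_simps: "c x = 1" "\<And>g. g \<noteq> x \<Longrightarrow> c g = 0" by (simp_all add: c_def)
  have "csum zs = count (mset zs) x" by (induction zs) (auto simp: c_simps)
  moreover have "count (mset zs) x \<le> count ?S x" using zs(1) by (rule mset_subset_eq_count)
  ultimately have "csum zs < p" using \<open>x \<noteq> y\<close> p1 by simp
  then have "csum zs = 0" using dvd(1) by (meson nat_dvd_not_less not_gr_zero)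
  then have "count (mset zs) x = 0" using \<open>csum zs = count (mset zs) x\<close> by simp
  then have "x \<notin> set zs" by (metis count_eq_zero_iff set_mset_mset)
  then have ys: "set zs \<subseteq> {y}" using set_zs by blast
  have "wsum zs = int (length zs) \<and> csum zs = 0"
    using ys \<open>x \<noteq> y\<close> by (induction zs) (auto simp: c_def b_def)
  then have "m dvd length zs" using dvd(2) by simp
  moreover have "length zs = count (mset zs) y"
    using ys by (induction zs) auto
  moreover have "count (mset zs) y \<le> count ?S y" using zs(1) by (rule mset_subset_eq_count)
  ultimately have "m dvd length zs" "length zs < m" using \<open>x \<noteq> y\<close> m_ge_1 by auto
  then show False using zs(2) by (simp add: nat_dvd_not_less)
qed

theorem davenport_constants:
  shows "small_davenport G = m + p - 2 \<and> E_const G = small_davenport G + order G"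
proof -
  let ?S0 = "replicate_mset (m - 1) y + replicate_mset (p - 1) x"
  have p1: "p > 1" using prime_p by (rule prime_gt_1_nat)
  have pm: "p * m \<ge> 1" using p1 m_ge_1 by (simp add: Suc_leI)
  have S0: "set_mset ?S0 \<subseteq> carrier G" "size ?S0 = m + p - 2"
    using x_carrier y_carrier p1 m_ge_1 by auto
  have free_bound: "size S \<le> m + p - 2" if S: "set_mset S \<subseteq> carrier G" "product_one_free G S" for S
  proof (rule ccontr)
    assume "\<not> size S \<le> m + p - 2"
    then have "p * m + m + p - 2 \<le> size (replicate_mset (p * m - 1) \<one> + S)"
      using pm by simp
    \<comment> \<open>\<open>product_one_subsequence\<close> asks for one exact length, so the
      padded sequence is cut down to it.\<close>
    then obtain U where U: "U \<subseteq># replicate_mset (p * m - 1) \<one> + S" "size U = p * m + m + p - 2"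
      using submultiset_of_size by blast
    have "set_mset U \<subseteq> carrier G"
      using set_mset_mono[OF U(1)] S(1) by (auto split: if_splits)
    moreover have "size U + 2 = p * m + m + p" using U(2) p1 by simp
    ultimately obtain T where T: "T \<subseteq># U" "size T = order G" "product_one G T"
      using product_one_subsequence by blast
    have "T \<subseteq># replicate_mset (p * m - 1) \<one> + S" using T(1) U(1) by (rule subset_mset.order_trans)
    then show False
      using product_one_free_padding[OF S] T order_G pm by simp
  qed
  have d: "small_davenport G = m + p - 2"
    unfolding small_davenport_def
  proof (rule Max_eqI)
    show "finite {size S |S. set_mset S \<subseteq> carrier G \<and> product_one_free G S}"
      by (rule finite_subset[of _ "{..m + p - 2}"]) (use free_bound in auto)
    show "n \<le> m + p - 2" if "n \<in> {size S |S. set_mset S \<subseteq> carrier G \<and> product_one_free G S}" for n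
      using that free_bound by auto
    show "m + p - 2 \<in> {size S |S. set_mset S \<subseteq> carrier G \<and> product_one_free G S}"
      using S0 extremal_product_one_free by (intro CollectI exI[of _ ?S0]) auto
  qed
  have "E_const G = p * m + m + p - 2"
    unfolding E_const_def
  proof (rule Least_equality)
    have "size S + 2 = p * m + m + p" if "size S = p * m + m + p - 2" for S :: "'a multiset"
      using that p1 by simp
    then show "\<forall>S. set_mset S \<subseteq> carrier G \<and> size S = p * m + m + p - 2 \<longrightarrow>
      (\<exists>T. T \<subseteq># S \<and> size T = order G \<and> product_one G T)"
      using product_one_subsequence by blast
  next
    fix t
    assume t: "\<forall>S. set_mset S \<subseteq> carrier G \<and> size S = t \<longrightarrow>
      (\<exists>T. T \<subseteq># S \<and> size T = order G \<and> product_one G T)"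
    show "p * m + m + p - 2 \<le> t"
    proof (rule ccontr)
      assume "\<not> p * m + m + p - 2 \<le> t"
      then have "t \<le> size (replicate_mset (p * m - 1) \<one> + ?S0)"
        using S0(2) pm p1 m_ge_1 by simp
      then obtain U where U: "U \<subseteq># replicate_mset (p * m - 1) \<one> + ?S0" "size U = t"
        using submultiset_of_size by blast
      have "set_mset U \<subseteq> carrier G"
        using set_mset_mono[OF U(1)] x_carrier y_carrier by (auto split: if_splits)
      then obtain T where T: "T \<subseteq># U" "size T = order G" "product_one G T"
        using t U(2) by blast
      have "T \<subseteq># replicate_mset (p * m - 1) \<one> + ?S0"
        using T(1) U(1) by (rule subset_mset.order_trans)
      then show False
        using product_one_free_padding[OF S0(1) extremal_product_one_free] T order_G pm by simp
    qed
  qed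
  then show ?thesis using d order_G p1 by simp
qed

end

theorem theorem1p4:
  fixes G (structure) and p m :: nat and r :: int and x y :: 'a
  assumes "group G"
    and "Factorial_Ring.prime p" and "m \<ge> 1"
    and "r ^ p mod int m = 1 mod int m"
    and "x \<in> carrier G" and "y \<in> carrier G"
    and "x [^] p = \<one>" and "y [^] m = \<one>"
    and "inv x \<otimes> y \<otimes> x = y [^] r"
    and "generate G {x, y} = carrier G"
    and "finite (carrier G)" and "order G = p * m"
    and "\<forall>q. Factorial_Ring.prime (q::nat) \<and> q dvd order G \<longrightarrow> p \<le> q"
    and "gcd (int p * (r - 1)) (int m) = 1"
  shows "small_davenport G = m + p - 2 \<and> E_const G = small_davenport G + order G"
proof -
  have "coprime (r - 1) (int m)"
    using assms(14) by (simp add: coprime_iff_gcd_eq_1[symmetric])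
  then interpret metacyclic_group G p m r x y
    using assms by (intro metacyclic_group.intro metacyclic_group_axioms.intro) (auto simp: cong_def)
  show ?thesis by (rule davenport_constants)
qed

end
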